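(* Let $S$ be a convex monotone $C_0$-semigroup on $X$ which is continuous from above, with monotone generator $A_\delta$. Let $y\colon[0,\infty)\to X$ be a (norm-)continuous function with $y(t)\in D(A_\delta)$ for all $t\ge0$, and assume that, for all $t\ge0$ and every sequence $(h_n)_{n\in\mathbb{N}}$ in $(0,\infty)$ with $h_n\downarrow0$, there exists a bounded decreasing sequence $(B_ny(t))_{n\in\mathbb{N}}$ in $X$ such that \[\Big\|\frac{y(t+h_n)-y(t)}{h_n}-B_ny(t)\Big\|\to0\quad\text{and}\quad B_ny(t)\downarrow A_\delta y(t).\] Then $y(t)=S(t)x$ for all $t\ge0$, where $x:=y(0)$.
   Context: Standing setting: $X$ is a real Banach lattice which is a Riesz subspace of a Dedekind $\sigma$-complete Riesz space $\overline X$. For a sequence $(x_n)_{n\in\mathbb{N}}$, write $x_n\downarrow x$ if $(x_n)$ is decreasing, bounded from below (by an element of $X$), and $x=\inf_n x_n\in\overline X$. Let $X_\delta:=\{x\in\overline X\colon x_n\downarrow x \text{ for some sequence }(x_n)_{n\in\mathbb{N}}\text{ in }X\}$. Let $M$ be the space of all positive linear functionals $\mu\colon X\to\mathbb{R}$ that are continuous from above, i.e. $\mu x_n\downarrow 0$ for every sequence $(x_n)$ in $X$ with $x_n\downarrow 0$. Every $\mu\in M$ has a unique extension $\mu\colon X_\delta\to\mathbb{R}$ which is continuous from above, i.e. $\mu x_n\downarrow\mu x$ for every sequence $(x_n)$ in $X_\delta$ with $x_n\downarrow x\in X_\delta$. It is assumed that $M$ separates the points of $X_\delta$. An operator $T\colon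 X\to X$ is convex if $T(\lambda x+(1-\lambda)y)\le\lambda Tx+(1-\lambda)Ty$ for all $x,y\in X$, $\lambda\in[0,1]$; monotone if $x\le y$ implies $Tx\le Ty$; bounded if $\sup_{\|x\|\le r}\|Tx\|<\infty$ for all $r>0$. A $C_0$-semigroup on $X$ is a family $S=(S(t))_{t\ge0}$ of bounded (possibly nonlinear) operators $X\to X$ with $S(0)x=x$, $S(t+s)x=S(t)S(s)x$ for all $s,t\ge0$, and $S(t)x\to x$ in norm as $t\downarrow 0$, for all $x\in X$. It is convex (monotone) if each $S(t)$ is. A monotone $C_0$-semigroup is continuous from above if $S(t)x_n\downarrow S(t)0$ for all $t\ge0$ and every sequence $(x_n)$ in $X$ with $x_n\downarrow 0$. Monotone generator: $D(A_\delta)$ is the set of all $x\in X$ such that for every sequence $(h_n)$ in $(0,\infty)$ with $h_n\downarrow0$ there exist a sequence $(A_nx)_{n\in\mathbb{N}}$ in $X$ and some $y\in X_\delta$ with $\big\|\frac{S(h_n)x-x}{h_n}-A_nx\big\|\to0$ and $A_nx\downarrow y$; then $y$ is uniquely determined and $A_\delta x:=y$. *)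

theory Defs
  imports "HOL-Analysis.Analysis" "HOL-Library.Lattice_Algebras"
begin

class riesz_space = ordered_real_vector + lattice_ab_group_add_abs

class sigma_complete_riesz_space = riesz_space +
  assumes sigma_complete:
    "countable A \<Longrightarrow> A \<noteq> {} \<Longrightarrow> bdd_above A \<Longrightarrow>
      \<exists>s. (\<forall>a\<in>A. a \<le> s) \<and> (\<forall>b. (\<forall>a\<in>A. a \<le> b) \<longrightarrow> s \<le> b)"

class banach_lattice = banach + riesz_space +
  assumes norm_lattice: "\<bar>x\<bar> \<le> \<bar>y\<bar> \<Longrightarrow> norm x \<le> norm y"

text \<open>The inclusion of the Banach lattice \<open>X\<close> into the Riesz space \<open>Xbar\<close> is an injective linear
  lattice homomorphism \<open>\<iota>\<close>, so that \<open>X\<close> (the type \<open>'a\<close>) is identified with the Riesz subspace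
  \<open>range \<iota>\<close> of \<open>Xbar\<close> (the type \<open>'b\<close>). Preservation of \<open>inf\<close> and of the order in both
  directions follows.\<close>

definition riesz_embedding :: "('a::riesz_space \<Rightarrow> 'b::riesz_space) \<Rightarrow> bool" where
  "riesz_embedding \<iota> \<longleftrightarrow> linear \<iota> \<and> inj \<iota> \<and> (\<forall>x y. \<iota> (sup x y) = sup (\<iota> x) (\<iota> y))"

definition decreases_to :: "(nat \<Rightarrow> 'c::order) \<Rightarrow> 'c \<Rightarrow> bool" where
  "decreases_to u a \<longleftrightarrow>
     decseq u \<and> (\<forall>n. a \<le> u n) \<and> (\<forall>b. (\<forall>n. b \<le> u n) \<longrightarrow> b \<le> a)"

text \<open>The infimum in \<open>u \<down> a\<close> is always the one in \<open>Xbar\<close>, also for sequences in \<open>X\<close>;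
  infima computed in \<open>X\<close> may differ.\<close>

definition down :: "('a::riesz_space \<Rightarrow> 'b::riesz_space) \<Rightarrow> (nat \<Rightarrow> 'b) \<Rightarrow> 'b \<Rightarrow> bool" where
  "down \<iota> u a \<longleftrightarrow> (\<exists>l. \<forall>n. \<iota> l \<le> u n) \<and> decreases_to u a"

definition X_delta :: "('a::riesz_space \<Rightarrow> 'b::riesz_space) \<Rightarrow> 'b set" where
  "X_delta \<iota> = {a. \<exists>x. down \<iota> (\<lambda>n. \<iota> (x n)) a}"

definition M_space :: "('a::riesz_space \<Rightarrow> 'b::riesz_space) \<Rightarrow> ('a \<Rightarrow> real) set" where
  "M_space \<iota> = {\<mu>. linear \<mu> \<and> (\<forall>x\<ge>0. \<mu> x \<ge> 0) \<and>
     (\<forall>x. down \<iota> (\<lambda>n. \<iota> (x n)) 0 \<longrightarrow> decreases_to (\<lambda>n. \<mu> (x n)) 0)}"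

text \<open>\<open>\<nu>\<close> is the extension of \<open>\<mu>\<close> to \<open>X_delta \<iota>\<close> which is continuous from above. For
  \<open>\<mu> \<in> M_space \<iota>\<close> its restriction to \<open>X_delta \<iota>\<close> exists and is unique; the values of \<open>\<nu>\<close>
  outside \<open>X_delta \<iota>\<close> are irrelevant.\<close>

definition delta_extension ::
    "('a::riesz_space \<Rightarrow> 'b::riesz_space) \<Rightarrow> ('a \<Rightarrow> real) \<Rightarrow> ('b \<Rightarrow> real) \<Rightarrow> bool" where
  "delta_extension \<iota> \<mu> \<nu> \<longleftrightarrow> (\<forall>x. \<nu> (\<iota> x) = \<mu> x) \<and>
     (\<forall>u. \<forall>a\<in>X_delta \<iota>. (\<forall>n. u n \<in> X_delta \<iota>) \<longrightarrow> down \<iota> u a \<longrightarrow>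
        decreases_to (\<lambda>n. \<nu> (u n)) (\<nu> a))"

definition M_separates_X_delta :: "('a::riesz_space \<Rightarrow> 'b::riesz_space) \<Rightarrow> bool" where
  "M_separates_X_delta \<iota> \<longleftrightarrow>
     (\<forall>a\<in>X_delta \<iota>. \<forall>b\<in>X_delta \<iota>. a \<noteq> b \<longrightarrow>
        (\<exists>\<mu>\<in>M_space \<iota>. \<exists>\<nu>. delta_extension \<iota> \<mu> \<nu> \<and> \<nu> a \<noteq> \<nu> b))"

definition convex_operator :: "('a::banach_lattice \<Rightarrow> 'a) \<Rightarrow> bool" where
  "convex_operator T \<longleftrightarrow> (\<forall>x y. \<forall>c\<in>{0..1}.
     T (c *\<^sub>R x + (1 - c) *\<^sub>R y) \<le> c *\<^sub>R T x + (1 - c) *\<^sub>R T y)"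

definition bounded_operator :: "('a::real_normed_vector \<Rightarrow> 'a) \<Rightarrow> bool" where
  "bounded_operator T \<longleftrightarrow> (\<forall>r>0. bdd_above ((\<lambda>x. norm (T x)) ` {x. norm x \<le> r}))"

text \<open>Only the values of \<open>S t\<close> for \<open>t \<ge> 0\<close> matter.\<close>

definition C0_semigroup :: "(real \<Rightarrow> 'a::real_normed_vector \<Rightarrow> 'a) \<Rightarrow> bool" where
  "C0_semigroup S \<longleftrightarrow>
     (\<forall>t\<ge>0. bounded_operator (S t)) \<and>
     (\<forall>x. S 0 x = x) \<and>
     (\<forall>s\<ge>0. \<forall>t\<ge>0. \<forall>x. S (t + s) x = S t (S s x)) \<and>
     (\<forall>x. ((\<lambda>t. S t x) \<longlongrightarrow> x) (at_right 0))"

definition semigroup_cont_above ::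
    "('a::riesz_space \<Rightarrow> 'b::riesz_space) \<Rightarrow> (real \<Rightarrow> 'a \<Rightarrow> 'a) \<Rightarrow> bool" where
  "semigroup_cont_above \<iota> S \<longleftrightarrow>
     (\<forall>t\<ge>0. \<forall>x. down \<iota> (\<lambda>n. \<iota> (x n)) 0 \<longrightarrow> down \<iota> (\<lambda>n. \<iota> (S t (x n))) (\<iota> (S t 0)))"

definition delta_limit ::
    "('a::banach_lattice \<Rightarrow> 'b::riesz_space) \<Rightarrow> (real \<Rightarrow> 'a \<Rightarrow> 'a) \<Rightarrow> 'a \<Rightarrow> (nat \<Rightarrow> real) \<Rightarrow> 'b \<Rightarrow> bool" where
  "delta_limit \<iota> S x h a \<longleftrightarrow> a \<in> X_delta \<iota> \<and>
     (\<exists>A. (\<lambda>n. norm ((S (h n) x - x) /\<^sub>R h n - A n)) \<longlonglongrightarrow> 0 \<and> down \<iota> (\<lambda>n. \<iota> (A n)) a)"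

definition gen_domain ::
    "('a::banach_lattice \<Rightarrow> 'b::riesz_space) \<Rightarrow> (real \<Rightarrow> 'a \<Rightarrow> 'a) \<Rightarrow> 'a set" where
  "gen_domain \<iota> S =
     {x. \<forall>h. (\<forall>n. h n > 0) \<longrightarrow> decreases_to h 0 \<longrightarrow> (\<exists>a. delta_limit \<iota> S x h a)}"

text \<open>In \<open>gen_domain\<close> the limit may a priori depend on \<open>h\<close>. When \<open>M\<close> separates the points
  of \<open>X_delta\<close> it does not (compare two sequences with their decreasing merge), so for
  \<open>x \<in> gen_domain \<iota> S\<close> the description below is well defined.\<close>

definition generator ::
    "('a::banach_lattice \<Rightarrow> 'b::riesz_space) \<Rightarrow> (real \<Rightarrow> 'a \<Rightarrow> 'a) \<Rightarrow> 'a \<Rightarrow> 'b" where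
  "generator \<iota> S x =
     (THE a. \<forall>h. (\<forall>n. h n > 0) \<longrightarrow> decreases_to h 0 \<longrightarrow> delta_limit \<iota> S x h a)"

end

theory Submission
  imports Defs
begin

text \<open>
  Fix \<open>\<mu> \<in> M\<close> and \<open>0 < t < c < d\<close> and consider
  \<open>G s = (\<integral>T\<in>[c, d]. \<mu> (S (T - s) (y s)))\<close> for \<open>0 \<le> s \<le> t\<close>. Substituting \<open>r = T - s - h\<close>,
  the increment \<open>G (s + h) - G s\<close> is an integral over \<open>r\<close> of
  \<open>\<mu> (S r (y (s + h))) - \<mu> (S r (S h (y s)))\<close>. Divided by \<open>h\<close> the integrand tends to \<open>0\<close> for each
  fixed \<open>r > 0\<close>: both \<open>y (s + h)\<close> and \<open>S h (y s)\<close> are \<open>y s\<close> plus \<open>h\<close> times terms decreasing to the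
  same element of \<open>X_delta\<close>, and by convexity and continuity from above the difference quotients
  of \<open>\<mu> \<circ> S r\<close> along them have the same infimum. The operators \<open>S r\<close> are Lipschitz on bounded
  sets, uniformly for \<open>r\<close> in a compact subset of \<open>(0, \<infinity>)\<close>, so dominated convergence shows that
  \<open>G\<close> has right derivative \<open>0\<close> and hence is constant. As \<open>c\<close> and \<open>d\<close> are arbitrary,
  \<open>\<mu> (S (T - t) (y t)) = \<mu> (S T (y 0))\<close> for all \<open>T > t\<close>; let \<open>T\<close> tend to \<open>t\<close>.
\<close>

section \<open>Decreasing sequences in Banach lattices\<close>

lemma decreases_to_real_iff:
  fixes h :: "nat \<Rightarrow> real"
  shows "decreases_to h a \<longleftrightarrow> decseq h \<and> h \<longlonglongrightarrow> a"
proof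
  assume *: "decreases_to h a"
  then have dec: "decseq h" and lb: "\<And>n. a \<le> h n" and gr: "\<And>b. (\<And>n. b \<le> h n) \<Longrightarrow> b \<le> a"
    unfolding decreases_to_def by blast+
  obtain L where L: "h \<longlonglongrightarrow> L" "\<And>n. L \<le> h n"
    using decseq_convergent[OF dec] lb by blast
  have "L = a"
    using gr[of L] L LIMSEQ_le_const[OF L(1), of a] lb by (meson order_antisym)
  then show "decseq h \<and> h \<longlonglongrightarrow> a" using dec L by simp
next
  assume *: "decseq h \<and> h \<longlonglongrightarrow> a"
  then show "decreases_to h a"
    unfolding decreases_to_def by (auto intro: decseq_ge LIMSEQ_le_const)
qed

lemma riesz_embedding_linear: "riesz_embedding \<iota> \<Longrightarrow> linear \<iota>"
  by (simp add: riesz_embedding_def)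

lemma riesz_embedding_le_iff:
  assumes "riesz_embedding \<iota>"
  shows "\<iota> x \<le> \<iota> y \<longleftrightarrow> x \<le> y"
  using assms unfolding riesz_embedding_def le_iff_sup by (metis injD)

lemma norm_abs_banach_lattice [simp]: "norm \<bar>x\<bar> = norm (x::'a::banach_lattice)"
  by (rule antisym) (simp_all add: norm_lattice)

text \<open>Both \<open>x\<close> and \<open>- x\<close> lie below
  \<open>\<bar>l\<bar> + \<bar>u\<bar>\<close>.\<close>

lemma norm_le_of_between:
  fixes x :: "'a::banach_lattice"
  assumes "l \<le> x" "x \<le> u"
  shows "norm x \<le> norm l + norm u"
proof -
  have "x \<le> \<bar>l\<bar> + \<bar>u\<bar>"
    using assms(2) abs_ge_self[of u] abs_ge_zero[of l] by (metis add_increasing order.trans)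
  moreover have "- x \<le> \<bar>l\<bar> + \<bar>u\<bar>"
    using assms(1) abs_ge_minus_self[of l] abs_ge_zero[of u]
    by (metis add_increasing2 neg_le_iff_le order.trans)
  ultimately have "\<bar>x\<bar> \<le> \<bar>l\<bar> + \<bar>u\<bar>" by (rule abs_leI)
  also have "\<dots> = \<bar>\<bar>l\<bar> + \<bar>u\<bar>\<bar>" by (simp add: abs_of_nonneg)
  finally have "norm x \<le> norm (\<bar>l\<bar> + \<bar>u\<bar>)" by (rule norm_lattice)
  also have "\<dots> \<le> norm l + norm u" using norm_triangle_ineq[of "\<bar>l\<bar>" "\<bar>u\<bar>"] by simp
  finally show ?thesis .
qed

text \<open>Whenever \<open>0 \<le> X n\<close>, the negative part of \<open>x\<close> is dominated
  by \<open>\<bar>X n - x\<bar>\<close>, whose norm tends to 0.\<close>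

lemma nonneg_of_tendsto:
  fixes x :: "'a::banach_lattice"
  assumes lim: "X \<longlonglongrightarrow> x" and pos: "\<forall>\<^sub>F n in sequentially. 0 \<le> X n"
  shows "0 \<le> x"
proof -
  have "norm (sup (- x) 0) \<le> norm (X n - x)" if "0 \<le> X n" for n
  proof (rule norm_lattice)
    have "- x \<le> \<bar>X n - x\<bar>"
      using that abs_ge_self[of "X n - x"] by (metis add_increasing diff_conv_add_uminus order.trans order_refl)
    then show "\<bar>sup (- x) 0\<bar> \<le> \<bar>X n - x\<bar>" by (simp add: abs_of_nonneg)
  qed
  then have "\<forall>\<^sub>F n in sequentially. norm (sup (- x) 0) \<le> norm (X n - x)"
    using pos by (auto elim: eventually_mono)
  moreover have "(\<lambda>n. norm (X n - x)) \<longlonglongrightarrow> 0"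
    using lim by (simp add: LIM_zero tendsto_norm_zero)
  ultimately have "norm (sup (- x) 0) \<le> 0"
    by (metis tendsto_lowerbound trivial_limit_sequentially)
  then have "sup (- x) 0 = 0" by simp
  then have "- x \<le> 0" by (metis sup_ge1)
  then show ?thesis by simp
qed

text \<open>This rests on completeness: were \<open>\<mu>\<close> unbounded, some norm convergent
  series of positive vectors would have a sum dominating every term, although the values of
  \<open>\<mu>\<close> on the terms are unbounded.\<close>

lemma positive_linear_imp_bounded_linear:
  fixes \<mu> :: "'a::banach_lattice \<Rightarrow> real"
  assumes lin: "linear \<mu>" and pos: "\<And>x. 0 \<le> x \<Longrightarrow> 0 \<le> \<mu> x"
  shows "bounded_linear \<mu>"
proof -
  have mono: "\<mu> x \<le> \<mu> y" if "x \<le> y" for x y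
    using pos[of "y - x"] that by (simp add: linear_diff[OF lin])
  have abs: "\<bar>\<mu> x\<bar> \<le> \<mu> \<bar>x\<bar>" for x
    using mono[OF abs_ge_self, of x] mono[OF abs_ge_minus_self, of x] linear_neg[OF lin, of x] by auto
  have "\<exists>C. \<forall>x. \<bar>\<mu> x\<bar> \<le> C * norm x"
  proof (rule ccontr)
    assume "\<nexists>C. \<forall>x. \<bar>\<mu> x\<bar> \<le> C * norm x"
    then have "\<forall>n::nat. \<exists>x. 4 ^ n * norm x < \<bar>\<mu> x\<bar>" by (metis not_le)
    then obtain x where x: "\<And>n. 4 ^ n * norm (x n) < \<bar>\<mu> (x n)\<bar>" by metis
    have nz: "norm (x n) > 0" for n using x[of n] linear_0[OF lin] by (cases "x n = 0") auto
    \<comment> \<open>The factor \<open>4 ^ n\<close> in the choice of \<open>x\<close> is split: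
      one \<open>2 ^ n\<close> makes the norms of \<open>z\<close> summable, the other makes
      \<open>\<mu> (z n)\<close> at least \<open>2 ^ n\<close>.\<close>
    define z where "z n = (1 / (2 ^ n * norm (x n))) *\<^sub>R \<bar>x n\<bar>" for n
    have zpos: "0 \<le> z n" for n unfolding z_def by (simp add: scaleR_nonneg_nonneg)
    have znorm: "norm (z n) = (1/2) ^ n" for n
      using nz[of n] by (simp add: z_def power_one_over)
    have "summable (\<lambda>n. norm (z n))" unfolding znorm by simp
    then have sm: "summable z" by (rule summable_norm_cancel)
    have le: "z n \<le> suminf z" for n
    proof -
      have "(\<lambda>m. sum z {..<m} - z n) \<longlonglongrightarrow> suminf z - z n"
        by (intro tendsto_intros summable_LIMSEQ sm)
      moreover have "\<forall>\<^sub>F m in sequentially. 0 \<le> sum z {..<m} - z n"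
        using eventually_gt_at_top[of n]
      proof eventually_elim
        case (elim m)
        have "sum z {n} \<le> sum z {..<m}"
          by (rule sum_mono2) (use elim zpos in auto)
        then show ?case by simp
      qed
      ultimately have "0 \<le> suminf z - z n" by (rule nonneg_of_tendsto)
      then show ?thesis by simp
    qed
    have "2 ^ n \<le> \<mu> (suminf z)" for n
    proof -
      have "(2::real) ^ n = 4 ^ n * norm (x n) / (2 ^ n * norm (x n))"
        using nz[of n] by (simp add: field_simps flip: power_mult_distrib)
      also have "\<dots> \<le> \<mu> \<bar>x n\<bar> / (2 ^ n * norm (x n))"
        using x[of n] abs[of "x n"] nz[of n] by (intro divide_right_mono) auto
      also have "\<dots> = \<mu> (z n)" unfolding z_def by (simp add: linear_scale[OF lin])
      also have "\<dots> \<le> \<mu> (suminf z)" by (rule mono[OF le])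
      finally show ?thesis .
    qed
    then show False using real_arch_pow[of 2 "\<mu> (suminf z)"] by (metis not_less one_less_numeral_iff semiring_norm(76))
  qed
  then obtain C where "\<And>x. \<bar>\<mu> x\<bar> \<le> C * norm x" by blast
  then show ?thesis
    by (intro bounded_linear_intro[where K = C]) (auto simp: linear_add[OF lin] linear_scale[OF lin] mult.commute)
qed

lemma M_space_mono: "\<mu> \<in> M_space \<iota> \<Longrightarrow> x \<le> y \<Longrightarrow> \<mu> x \<le> \<mu> y"
  unfolding M_space_def using linear_diff[of \<mu> y x] by (smt (verit) diff_ge_0_iff_ge mem_Collect_eq)

lemma M_space_bounded_linear:
  fixes \<mu> :: "'a::banach_lattice \<Rightarrow> real"
  shows "\<mu> \<in> M_space \<iota> \<Longrightarrow> bounded_linear \<mu>"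
  unfolding M_space_def by (blast intro: positive_linear_imp_bounded_linear)

section \<open>The relation \<open>down\<close>: boundedness, scaling and truncation\<close>

lemma down_decseq:
  assumes "riesz_embedding \<iota>" "down \<iota> (\<lambda>n. \<iota> (x n)) a"
  shows "decseq x"
  using assms riesz_embedding_le_iff[OF assms(1)] unfolding down_def decreases_to_def decseq_def by auto

lemma down_lower_bound:
  assumes "riesz_embedding \<iota>" "down \<iota> (\<lambda>n. \<iota> (x n)) a"
  shows "\<exists>l. \<forall>n. l \<le> x n"
  using assms riesz_embedding_le_iff[OF assms(1)] unfolding down_def by auto

text \<open>The lower bound in \<open>down\<close> is taken from \<open>X\<close>, so the sequence
  lies in an order interval of \<open>X\<close>.\<close>

lemma down_bounded:
  fixes x :: "nat \<Rightarrow> 'a::banach_lattice"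
  assumes "riesz_embedding \<iota>" "down \<iota> (\<lambda>n. \<iota> (x n)) a"
  obtains K where "\<And>n. norm (x n) \<le> K"
proof -
  obtain l where l: "\<And>n. l \<le> x n" using down_lower_bound[OF assms] by blast
  have "x n \<le> x 0" for n using down_decseq[OF assms] by (simp add: decseq_def)
  then have "norm (x n) \<le> norm l + norm (x 0)" for n using l norm_le_of_between by blast
  then show ?thesis by (rule that)
qed

lemma down_le: "down \<iota> u a \<Longrightarrow> a \<le> u n"
  by (simp add: down_def decreases_to_def)

lemma down_scaleR:
  assumes \<iota>: "riesz_embedding \<iota>" and d: "down \<iota> (\<lambda>n. \<iota> (x n)) 0" and c: "c > 0"
  shows "down \<iota> (\<lambda>n. \<iota> (c *\<^sub>R x n)) 0"
proof -
  note lin = riesz_embedding_linear[OF \<iota>]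
  have pos: "0 \<le> \<iota> (x n)" for n using down_le[OF d] .
  have pos': "0 \<le> \<iota> (c *\<^sub>R x n)" for n
    using pos[of n] c by (simp add: linear_scale[OF lin] scaleR_nonneg_nonneg)
  have "b \<le> 0" if "\<And>n. b \<le> \<iota> (c *\<^sub>R x n)" for b
  proof -
    have "(1 / c) *\<^sub>R b \<le> \<iota> (x n)" for n
      using scaleR_left_mono[OF that[of n], of "1 / c"] c by (simp add: linear_scale[OF lin])
    then have "(1 / c) *\<^sub>R b \<le> 0" using d unfolding down_def decreases_to_def by blast
    from scaleR_left_mono[OF this, of c] c show ?thesis by simp
  qed
  moreover have "decseq (\<lambda>n. \<iota> (c *\<^sub>R x n))"
    using down_decseq[OF \<iota> d] c
    by (auto simp: decseq_def riesz_embedding_le_iff[OF \<iota>] intro: scaleR_left_mono)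
  ultimately show ?thesis
    unfolding down_def decreases_to_def using pos' linear_0[OF lin] by (metis)
qed

text \<open>In \<open>Xbar\<close> the positive part lies between 0 and
  \<open>\<iota> (x n) - a\<close>, which decreases to 0. As \<open>a\<close> need not come from
  \<open>X\<close>, truncation serves to obtain from \<open>x\<close> a sequence in \<open>X\<close>
  that decreases to 0.\<close>

lemma down_pos_part_diff:
  assumes \<iota>: "riesz_embedding \<iota>" and d: "down \<iota> (\<lambda>n. \<iota> (x n)) a" and le: "a \<le> \<iota> z"
  shows "down \<iota> (\<lambda>n. \<iota> (sup (x n - z) 0)) 0"
proof -
  note lin = riesz_embedding_linear[OF \<iota>]
  have pos: "\<iota> 0 \<le> \<iota> (sup (x n - z) 0)" for n by (simp add: riesz_embedding_le_iff[OF \<iota>])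
  have "\<iota> (sup (x n - z) 0) \<le> \<iota> (x n) - a" for n
  proof -
    have "\<iota> (sup (x n - z) 0) = sup (\<iota> (x n) - \<iota> z) 0"
      using \<iota> by (simp add: riesz_embedding_def linear_diff linear_0)
    also have "\<dots> \<le> \<iota> (x n) - a"
      using le down_le[OF d, of n] by (intro sup_least) (auto intro: diff_left_mono)
    finally show ?thesis .
  qed
  then have "b + a \<le> \<iota> (x n)" if "\<And>n. b \<le> \<iota> (sup (x n - z) 0)" for b n
    using that[of n] by (metis le_diff_eq order.trans)
  then have "b \<le> 0" if "\<And>n. b \<le> \<iota> (sup (x n - z) 0)" for b
    using that d unfolding down_def decreases_to_def by (metis add_le_same_cancel2)
  moreover have "decseq (\<lambda>n. \<iota> (sup (x n - z) 0))"
    using down_decseq[OF \<iota> d]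
    by (auto simp: decseq_def riesz_embedding_le_iff[OF \<iota>] intro: le_supI1)
  ultimately show ?thesis
    unfolding down_def decreases_to_def using pos linear_0[OF lin] by metis
qed

section \<open>Uniform bounds for convex semigroups\<close>

text \<open>The segment from \<open>u\<close> to \<open>v\<close> is prolonged by length 1 beyond
  \<open>v\<close>; convexity then bounds \<open>T v - T u\<close> by a small multiple of
  \<open>T (ext u v) - T u\<close>. Exchanging the roles of the two points bounds the absolute
  value.\<close>

lemma convex_operator_lipschitz:
  fixes T :: "'a::banach_lattice \<Rightarrow> 'a"
  assumes T: "convex_operator T" and K: "\<And>z. norm z \<le> r + 1 \<Longrightarrow> norm (T z) \<le> K"
    and xx': "norm x \<le> r" "norm x' \<le> r"
  shows "norm (T x - T x') \<le> 4 * K * norm (x - x')"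
proof (cases "x = x'")
  case False
  define d where "d = norm (x - x')"
  \<comment> \<open>\<open>c\<close> is the weight of \<open>ext u v\<close> when \<open>v\<close>
    is written as a convex combination of \<open>ext u v\<close>, at distance 1 from
    \<open>v\<close>, and \<open>u\<close>, at distance \<open>d\<close>.\<close>
  define c where "c = d / (1 + d)"
  have d: "d > 0" using False by (simp add: d_def)
  have c: "0 \<le> c" "c \<le> 1" "c \<le> d" using d by (auto simp: c_def field_simps)
  define ext where "ext u v = v + (1 / d) *\<^sub>R (v - u)" for u v :: 'a
  have norm_ext: "norm (ext u v) \<le> r + 1" if "norm v \<le> r" "norm (v - u) = d" for u v
    using norm_triangle_ineq[of v "(1 / d) *\<^sub>R (v - u)"] that d by (simp add: ext_def)
  have ext: "T v - T u \<le> c *\<^sub>R (T (ext u v) - T u)" for u v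
  proof -
    have "1 + d \<noteq> 0" using d by simp
    then have "c / d = 1 - c" using d by (simp add: c_def divide_simps)
    then have "c *\<^sub>R ext u v + (1 - c) *\<^sub>R u = c *\<^sub>R v + (1 - c) *\<^sub>R (v - u) + (1 - c) *\<^sub>R u"
      by (simp add: ext_def scaleR_add_right)
    also have "\<dots> = v" by (simp add: algebra_simps)
    finally have "T v \<le> c *\<^sub>R T (ext u v) + (1 - c) *\<^sub>R T u"
      using T c unfolding convex_operator_def by (metis atLeastAtMost_iff)
    then show ?thesis by (simp add: algebra_simps)
  qed
  define p where "p = \<bar>T (ext x' x) - T x'\<bar>"
  define q where "q = \<bar>T (ext x x') - T x\<bar>"
  have p: "p \<ge> 0" and q: "q \<ge> 0" by (simp_all add: p_def q_def)
  have *: "T x - T x' \<le> c *\<^sub>R p" "- (T x - T x') \<le> c *\<^sub>R q"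
    using ext[of x x'] ext[of x' x] c(1) unfolding p_def q_def
    by (auto intro: order.trans[OF _ scaleR_left_mono[OF abs_ge_self]])
  have cp: "0 \<le> c *\<^sub>R p" and cq: "0 \<le> c *\<^sub>R q" using p q c by (simp_all add: scaleR_nonneg_nonneg)
  have "\<bar>T x - T x'\<bar> \<le> c *\<^sub>R p + c *\<^sub>R q"
    using * cp cq by (intro abs_leI) (meson add_increasing add_increasing2 order.trans order_refl)+
  then have "norm (T x - T x') \<le> norm (c *\<^sub>R p + c *\<^sub>R q)"
    by (intro norm_lattice) (use cp cq in simp)
  also have "\<dots> \<le> c * norm p + c * norm q"
    using norm_triangle_ineq[of "c *\<^sub>R p" "c *\<^sub>R q"] c by simp
  also have "\<dots> \<le> c * (2 * K) + c * (2 * K)"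
  proof -
    have "norm (T z - T w) \<le> 2 * K" if "norm z \<le> r + 1" "norm w \<le> r" for z w
      using norm_triangle_ineq4[of "T z" "T w"] K[of z] K[of w] that by simp
    from this[of "ext x' x" x'] this[of "ext x x'" x]
    have "norm p \<le> 2 * K" "norm q \<le> 2 * K"
      using norm_ext[of x x'] norm_ext[of x' x] xx' norm_minus_commute[of x' x]
      by (simp_all add: p_def q_def d_def)
    then show ?thesis using c by (intro add_mono mult_left_mono) auto
  qed
  also have "\<dots> = 4 * K * c" by simp
  also have "\<dots> \<le> 4 * K * d"
  proof -
    have "norm (T 0) \<le> K" using K[of 0] norm_ge_zero[of x] xx' by (simp del: norm_ge_zero)
    then have "K \<ge> 0" using norm_ge_zero order.trans by blast
    then show ?thesis using c by (intro mult_left_mono) auto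
  qed
  finally show ?thesis by (simp add: d_def)
qed simp

lemma bounded_operator_bound:
  assumes "bounded_operator T"
  shows "\<exists>K. \<forall>x. norm x \<le> r \<longrightarrow> norm (T x) \<le> K"
proof -
  \<comment> \<open>\<open>bounded_operator\<close> speaks of positive radii only, so
    \<open>r\<close> is enlarged to \<open>max r 1\<close>.\<close>
  have "bdd_above ((\<lambda>x. norm (T x)) ` {x. norm x \<le> max r 1})"
    using assms unfolding bounded_operator_def by simp
  then obtain K where "\<And>x. norm x \<le> max r 1 \<Longrightarrow> norm (T x) \<le> K"
    unfolding bdd_above_def by blast
  then show ?thesis by (intro exI[of _ K]) simp
qed

lemma bounded_convex_operator_continuous:
  fixes T :: "'a::banach_lattice \<Rightarrow> 'a"
  assumes T: "convex_operator T" and b: "bounded_operator T"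
  shows "isCont T x"
proof -
  obtain K where K: "\<And>z. norm z \<le> (norm x + 1) + 1 \<Longrightarrow> norm (T z) \<le> K"
    using bounded_operator_bound[OF b, of "norm x + 1 + 1"] by blast
  have ev: "\<forall>\<^sub>F z in at x. norm (T z - T x) \<le> 4 * K * norm (z - x)"
    unfolding eventually_at
  proof (intro exI[of _ 1] conjI ballI impI)
    fix z assume "z \<noteq> x \<and> dist z x < 1"
    then have "norm z \<le> norm x + 1" using norm_triangle_ineq2[of z x] by (simp add: dist_norm)
    then show "norm (T z - T x) \<le> 4 * K * norm (z - x)"
      by (intro convex_operator_lipschitz[OF T K]) auto
  qed simp
  have "((\<lambda>z. 4 * K * norm (z - x)) \<longlongrightarrow> 4 * K * norm (x - x)) (at x)"
    by (intro tendsto_intros)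
  then have "((\<lambda>z. norm (T z - T x)) \<longlongrightarrow> 0) (at x)"
    using ev by (intro tendsto_sandwich[OF _ ev tendsto_const]) auto
  then show ?thesis unfolding isCont_def by (rule LIM_zero_cancel[OF tendsto_norm_zero_cancel])
qed

locale convex_C0_semigroup =
  fixes S :: "real \<Rightarrow> 'a::banach_lattice \<Rightarrow> 'a"
  assumes C0: "C0_semigroup S"
    and convex: "\<And>t. t \<ge> 0 \<Longrightarrow> convex_operator (S t)"
begin

lemma semigroup_add: "s \<ge> 0 \<Longrightarrow> t \<ge> 0 \<Longrightarrow> S (t + s) x = S t (S s x)"
  using C0 by (simp add: C0_semigroup_def)

lemma bounded: "t \<ge> 0 \<Longrightarrow> bounded_operator (S t)"
  using C0 by (simp add: C0_semigroup_def)

lemma tendsto_at_zero: "((\<lambda>t. S t x) \<longlongrightarrow> x) (at_right 0)"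
  using C0 by (simp add: C0_semigroup_def)

lemma isCont_operator: "t \<ge> 0 \<Longrightarrow> isCont (S t) x"
  by (rule bounded_convex_operator_continuous[OF convex bounded])

text \<open>Right continuity follows from continuity of the single operator \<open>S t\<close>,
  applied to \<open>S h x\<close> as \<open>h\<close> tends to 0; left continuity has to wait for
  bounds uniform in time.\<close>

lemma tendsto_at_right:
  assumes "t \<ge> 0" shows "((\<lambda>s. S s x) \<longlongrightarrow> S t x) (at_right t)"
proof -
  have "((\<lambda>h. S (t + h) x) \<longlongrightarrow> S t x) (at_right 0)"
  proof (rule Lim_transform_eventually)
    show "((\<lambda>h. S t (S h x)) \<longlongrightarrow> S t x) (at_right 0)"
      by (rule isCont_tendsto_compose[OF isCont_operator[OF assms] tendsto_at_zero])
    show "\<forall>\<^sub>F h in at_right 0. S t (S h x) = S (t + h) x"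
      using eventually_at_right_less[of 0] by eventually_elim (use assms semigroup_add in simp)
  qed
  then show ?thesis
    unfolding at_right_to_0[of t] filterlim_filtermap by (simp add: add.commute)
qed

text \<open>Baire on \<open>{p..q}\<close>: the sets of times at which \<open>S t\<close> is bounded by \<open>N\<close> on the ball
  are closed under limits from the right, so a dense one contains the whole interval.\<close>

lemma exists_interval_bounded_on_ball:
  assumes pq: "0 \<le> p" "p < q"
  shows "\<exists>a b N. p \<le> a \<and> a < b \<and> b \<le> q \<and> (\<forall>t\<in>{a<..<b}. \<forall>x. norm x \<le> r \<longrightarrow> norm (S t x) \<le> N)"
proof -
  define E where "E N = {t \<in> {p..q}. \<forall>x. norm x \<le> r \<longrightarrow> norm (S t x) \<le> real N}" for N :: nat
  have cover: "\<exists>N. t \<in> E N" if "t \<in> {p..q}" for t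
  proof -
    have "t \<ge> 0" using that pq by simp
    then obtain K where "\<And>x. norm x \<le> r \<Longrightarrow> norm (S t x) \<le> K"
      using bounded_operator_bound[OF bounded] by blast
    then show ?thesis
      using that unfolding E_def by (auto intro!: exI[of _ "nat \<lceil>K\<rceil>"] intro: order.trans[OF _ real_nat_ceiling_ge])
  qed
  \<comment> \<open>Otherwise the sets \<open>{p..q} - closure (E N)\<close> would be relatively
    open and dense, and their intersection would be dense too, although the cover by the sets
    \<open>E N\<close> makes it empty.\<close>
  have "\<exists>N. \<not> {p..q} \<subseteq> closure ({p..q} - closure (E N))"
  proof (rule ccontr)
    assume *: "\<nexists>N. \<not> {p..q} \<subseteq> closure ({p..q} - closure (E N))"
    have "{p..q} \<subseteq> closure (\<Inter> (range (\<lambda>N. {p..q} - closure (E N))))"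
    proof (rule Baire)
      fix T assume "T \<in> range (\<lambda>N. {p..q} - closure (E N))"
      then obtain N where N: "T = {p..q} - closure (E N)" by blast
      then have "T = {p..q} \<inter> (- closure (E N))" by blast
      then have "openin (top_of_set {p..q}) T"
        by (metis closed_closure open_Compl openin_open_Int)
      then show "openin (top_of_set {p..q}) T \<and> {p..q} \<subseteq> closure T" using * N by blast
    qed auto
    moreover have "\<Inter> (range (\<lambda>N. {p..q} - closure (E N))) = {}"
    proof -
      have "t \<notin> \<Inter> (range (\<lambda>N. {p..q} - closure (E N)))" for t
        using cover[of t] closure_subset by blast
      then show ?thesis by blast
    qed
    ultimately have "{p..q} \<subseteq> {}" by (metis closure_empty)
    then show False using pq by simp
  qed
  then obtain N z where z: "z \<in> {p..q}" "z \<notin> closure ({p..q} - closure (E N))" by blast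
  then obtain e where e: "e > 0" "\<And>w. w \<in> {p..q} \<Longrightarrow> dist w z < e \<Longrightarrow> w \<in> closure (E N)"
    using closure_approachable[of z "{p..q} - closure (E N)"] by blast
  define a where "a = max p (z - e)"
  define b where "b = min q (z + e)"
  have ab: "p \<le> a" "a < b" "b \<le> q" using z(1) e(1) pq by (auto simp: a_def b_def)
  have cl: "w \<in> closure (E N)" if "w \<in> {a<..<b}" for w
  proof (rule e(2))
    have "p < w" "w < q" "\<bar>w - z\<bar> < e" using that unfolding a_def b_def by auto
    then show "w \<in> {p..q}" "dist w z < e" by (auto simp: dist_real_def)
  qed
  have "norm (S t x) \<le> N" if t: "t \<in> {a<..<b}" and x: "norm x \<le> r" for t x
  proof -
    have t0: "t \<ge> 0" using t ab pq by simp
    have "\<exists>\<^sub>F s in at_right t. norm (S s x) \<le> N"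
      unfolding frequently_def eventually_at_right_field
    proof safe
      fix c assume c: "c > t" "\<forall>s>t. s < c \<longrightarrow> \<not> norm (S s x) \<le> N"
      \<comment> \<open>A point within \<open>k\<close> of the midpoint \<open>w\<close> lies
        strictly between \<open>t\<close> and \<open>min b c\<close>.\<close>
      define w where "w = (t + min b c) / 2"
      define k where "k = (min b c - t) / 2"
      have k: "k > 0" "w - k \<ge> t" "w + k \<le> min b c" using t c by (auto simp: w_def k_def field_simps)
      have "w \<in> closure (E N)" using k t by (intro cl) auto
      then obtain s where "s \<in> E N" "dist s w < k" using k(1) unfolding closure_approachable by blast
      then have "norm (S s x) \<le> N" "s > t" "s < c" using x k by (auto simp: E_def dist_real_def)
      then show False using c by blast
    qed
    show ?thesis
    proof (rule ccontr)
      assume "\<not> norm (S t x) \<le> N"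
      then have "\<forall>\<^sub>F s in at_right t. norm (S s x) > N"
        using order_tendstoD(1)[OF tendsto_norm[OF tendsto_at_right[OF t0]]] by (simp add: not_le)
      with \<open>\<exists>\<^sub>F s in at_right t. norm (S s x) \<le> N\<close> show False
        by (simp add: frequently_def not_le)
    qed
  qed
  then show ?thesis using ab by blast
qed

text \<open>A bound on some short interval to the left of \<open>a\<close> is carried to
  \<open>{a..b}\<close> by the semigroup law: \<open>S t\<close> is \<open>S s\<close>, with
  \<open>s\<close> in the short interval, followed by one of finitely many bounded
  operators.\<close>

lemma bounded_on_ball_uniformly:
  assumes ab: "0 < a"
  shows "\<exists>K. \<forall>t\<in>{a..b}. \<forall>x. norm x \<le> r \<longrightarrow> norm (S t x) \<le> K"
proof -
  obtain p q N where pq: "0 \<le> p" "p < q" "q \<le> a"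
    and N: "\<And>t x. t \<in> {p<..<q} \<Longrightarrow> norm x \<le> r \<Longrightarrow> norm (S t x) \<le> N"
    using exists_interval_bounded_on_ball[of 0 a r] ab by blast
  \<comment> \<open>Going back a suitable number of steps of length \<open>m\<close> takes
    \<open>t \<ge> a\<close> into the half-open interval from \<open>e\<close> to
    \<open>e + m\<close>, the right half of the interval from \<open>p\<close> to
    \<open>q\<close>.\<close>
  define m where "m = (q - p) / 2"
  define e where "e = (p + q) / 2"
  have m: "m > 0" using pq by (simp add: m_def)
  have "\<exists>K. \<forall>j. \<forall>x. norm x \<le> N \<longrightarrow> norm (S (real j * m) x) \<le> K j"
    using m by (intro choice allI bounded_operator_bound bounded) simp
  then obtain K where K: "\<And>j x. norm x \<le> N \<Longrightarrow> norm (S (real j * m) x) \<le> K j" by blast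
  define J where "J = nat \<lceil>b / m\<rceil>"
  have "norm (S t x) \<le> (\<Sum>j\<le>J. \<bar>K j\<bar>)" if t: "t \<in> {a..b}" and x: "norm x \<le> r" for t x
  proof -
    define j where "j = nat \<lfloor>(t - e) / m\<rfloor>"
    define s where "s = t - real j * m"
    have te: "t - e \<ge> 0" using t pq by (auto simp: e_def)
    then have fl: "real j \<le> (t - e) / m" "(t - e) / m < real j + 1"
      using m by (auto simp: j_def)
    then have s: "e \<le> s" "s < e + m" using m by (auto simp: s_def field_simps)
    have "s \<in> {p<..<q}" using s pq by (auto simp: e_def m_def field_simps)
    then have "norm (S s x) \<le> N" using N x by blast
    then have "norm (S (real j * m) (S s x)) \<le> K j" by (rule K)
    moreover have "S t x = S (real j * m) (S s x)"
      using semigroup_add[of s "real j * m" x] s pq m by (simp add: s_def e_def)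
    moreover have "j \<le> J"
    proof -
      have "t - e \<le> b" using t pq(1,2) by (auto simp: e_def field_simps)
      then have "(t - e) / m \<le> b / m" using m by (intro divide_right_mono) auto
      then show ?thesis unfolding j_def J_def by (intro nat_mono) linarith
    qed
    then have "\<bar>K j\<bar> \<le> (\<Sum>j\<le>J. \<bar>K j\<bar>)" by (intro member_le_sum) auto
    ultimately show ?thesis by simp
  qed
  then show ?thesis by blast
qed

lemma lipschitz_uniformly:
  assumes "0 < a"
  obtains L where "L \<ge> 0" "\<And>t x x'. t \<in> {a..b} \<Longrightarrow> norm x \<le> r \<Longrightarrow> norm x' \<le> r \<Longrightarrow>
    norm (S t x - S t x') \<le> L * norm (x - x')"
proof -
  obtain K where K: "\<And>t x. t \<in> {a..b} \<Longrightarrow> norm x \<le> r + 1 \<Longrightarrow> norm (S t x) \<le> K"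
    using bounded_on_ball_uniformly[OF assms, of b "r + 1"] by blast
  have lip: "norm (S t x - S t x') \<le> (4 * \<bar>K\<bar>) * norm (x - x')"
    if "t \<in> {a..b}" "norm x \<le> r" "norm x' \<le> r" for t x x'
    using that assms by (intro convex_operator_lipschitz[OF convex])
      (auto intro: order.trans[OF K abs_ge_self])
  show ?thesis by (rule that[OF _ lip]) auto
qed

text \<open>For the left limit, \<open>S t x = S (t - h) (S h x)\<close>, so a Lipschitz constant
  common to all times in \<open>{t / 2..t}\<close> bounds the increment by a multiple of
  \<open>norm (S h x - x)\<close>.\<close>

lemma isCont_orbit:
  assumes t: "t > 0"
  shows "isCont (\<lambda>s. S s x) t"
proof -
  obtain L where L: "L \<ge> 0" "\<And>s z z'. s \<in> {t / 2..t} \<Longrightarrow> norm z \<le> norm x + 1 \<Longrightarrow> norm z' \<le> norm x + 1 \<Longrightarrow>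
    norm (S s z - S s z') \<le> L * norm (z - z')"
    using lipschitz_uniformly[of "t / 2"] t by auto
  have "((\<lambda>h. S (t - h) x) \<longlongrightarrow> S t x) (at_right 0)"
  proof -
    have ev1: "\<forall>\<^sub>F h in at_right 0. norm (S h x - x) < 1"
      using tendstoD[OF tendsto_at_zero[of x], of 1] by (simp add: dist_norm)
    have "\<forall>\<^sub>F h in at_right 0. h < t / 2"
      using t by (intro order_tendstoD(2)[OF tendsto_ident_at]) auto
    then have "\<forall>\<^sub>F h in at_right 0. norm (S (t - h) x - S t x) \<le> norm (S h x - x) * L"
      using ev1 eventually_at_right_less[of 0]
    proof eventually_elim
      case (elim h)
      have "S t x = S (t - h) (S h x)" using semigroup_add[of h "t - h" x] elim by simp
      moreover have "norm (S h x) \<le> norm x + 1"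
        using elim norm_triangle_ineq2[of "S h x" x] by simp
      ultimately show ?case
        using L(2)[of "t - h" x "S h x"] elim t by (simp add: norm_minus_commute mult.commute)
    qed
    moreover have "((\<lambda>h. S h x - x) \<longlongrightarrow> 0) (at_right 0)" by (rule LIM_zero[OF tendsto_at_zero])
    ultimately have "((\<lambda>h. S (t - h) x - S t x) \<longlongrightarrow> 0) (at_right 0)"
      by (rule tendsto_0_le[rotated])
    then show ?thesis by (rule LIM_zero_cancel)
  qed
  then have "((\<lambda>s. S s x) \<longlongrightarrow> S t x) (at_left t)"
    unfolding filterlim_at_left_to_right[of _ _ t] filterlim_at_right_to_0[of _ _ "- t"] by simp
  then show ?thesis
    unfolding isCont_def using tendsto_at_right[of t x] t by (intro filterlim_split_at) simp_all
qed

text \<open>Local Lipschitz continuity in the vector, uniform in time, is combined with continuity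
  of a single orbit. This makes the integrals of orbits below exist and depend continuously on
  parameters.\<close>

lemma continuous_on_semigroup: "continuous_on ({0<..} \<times> UNIV) (\<lambda>(t, x). S t x)"
proof -
  have "isCont (\<lambda>(t, x). S t x) (t, x)" if t: "t > 0" for t x
  proof -
    obtain L where L: "L \<ge> 0" "\<And>s z z'. s \<in> {t / 2..2 * t} \<Longrightarrow> norm z \<le> norm x + 1 \<Longrightarrow> norm z' \<le> norm x + 1 \<Longrightarrow>
      norm (S s z - S s z') \<le> L * norm (z - z')"
      using lipschitz_uniformly[of "t / 2"] t by auto
    have f: "(fst \<longlongrightarrow> t) (at (t, x))" and s: "(snd \<longlongrightarrow> x) (at (t, x))"
      by (auto intro!: tendsto_eq_intros)
    have lim: "((\<lambda>p. L * norm (snd p - x) + norm (S (fst p) x - S t x)) \<longlongrightarrow>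
        L * norm (x - x) + norm (S t x - S t x)) (at (t, x))"
      by (intro tendsto_intros f s isCont_tendsto_compose[OF isCont_orbit[OF t]])
    have "\<forall>\<^sub>F p in at (t, x). fst p > t / 2" "\<forall>\<^sub>F p in at (t, x). fst p < 2 * t"
      "\<forall>\<^sub>F p in at (t, x). dist (snd p) x < 1"
      using t by (intro order_tendstoD[OF f] tendstoD[OF s]; simp)+
    then have "\<forall>\<^sub>F p in at (t, x). norm (S (fst p) (snd p) - S t x)
        \<le> L * norm (snd p - x) + norm (S (fst p) x - S t x)"
    proof eventually_elim
      case (elim p)
      then have "norm (snd p) \<le> norm x + 1"
        using norm_triangle_ineq2[of "snd p" x] by (simp add: dist_norm)
      then have "norm (S (fst p) (snd p) - S (fst p) x) \<le> L * norm (snd p - x)"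
        using elim by (intro L(2)) auto
      then show ?case
        using norm_triangle_ineq[of "S (fst p) (snd p) - S (fst p) x" "S (fst p) x - S t x"] by simp
    qed
    then have "((\<lambda>p. norm (S (fst p) (snd p) - S t x)) \<longlongrightarrow> 0) (at (t, x))"
      by (rule tendsto_sandwich[OF always_eventually _ tendsto_const, rotated]) (use lim in simp_all)
    then have "((\<lambda>p. S (fst p) (snd p)) \<longlongrightarrow> S t x) (at (t, x))"
      by (rule LIM_zero_cancel[OF tendsto_norm_zero_cancel])
    then show ?thesis unfolding isCont_def case_prod_unfold by (simp only: fst_conv snd_conv)
  qed
  then show ?thesis by (auto intro!: continuous_at_imp_continuous_on)
qed

end

section \<open>Difference quotients and the monotone generator\<close>

text \<open>The point \<open>u + h *\<^sub>R b\<close> divides the segment from \<open>u\<close> to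
  \<open>u + k *\<^sub>R b\<close> with weight \<open>h / k\<close>.\<close>

lemma convex_quotient_mono:
  fixes \<phi> :: "'a::real_vector \<Rightarrow> real"
  assumes cvx: "convex_on UNIV \<phi>" and hk: "0 < h" "h \<le> k"
  shows "(\<phi> (u + h *\<^sub>R b) - \<phi> u) / h \<le> (\<phi> (u + k *\<^sub>R b) - \<phi> u) / k"
proof -
  define c where "c = h / k"
  have c: "0 \<le> c" "c \<le> 1" "c * k = h" using hk by (auto simp: c_def)
  have "u + h *\<^sub>R b = (1 - c) *\<^sub>R u + c *\<^sub>R (u + k *\<^sub>R b)"
    using c(3) by (simp add: algebra_simps flip: c(3))
  then have "\<phi> (u + h *\<^sub>R b) \<le> (1 - c) * \<phi> u + c * \<phi> (u + k *\<^sub>R b)"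
    using convex_onD[OF cvx, of c u "u + k *\<^sub>R b"] c by simp
  then have "\<phi> (u + h *\<^sub>R b) - \<phi> u \<le> c * (\<phi> (u + k *\<^sub>R b) - \<phi> u)"
    by (simp add: algebra_simps)
  then have "(\<phi> (u + h *\<^sub>R b) - \<phi> u) / h \<le> c * (\<phi> (u + k *\<^sub>R b) - \<phi> u) / h"
    using hk by (intro divide_right_mono) auto
  then show ?thesis using hk by (simp add: c_def)
qed

text \<open>Continuity from above at 0 is moved to \<open>x\<close> by writing
  \<open>x + d n\<close> as the combination of \<open>x / (1 - c)\<close> and \<open>d n / c\<close>
  with weights \<open>1 - c\<close> and \<open>c\<close>. First \<open>n\<close> tends to infinity,
  then \<open>c\<close> tends to 0.\<close>

lemma convex_functional_cont_above:
  fixes \<phi> :: "'a::banach_lattice \<Rightarrow> real"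
  assumes \<iota>: "riesz_embedding \<iota>" and cvx: "convex_on UNIV \<phi>" and mono: "mono \<phi>"
    and cont: "isCont \<phi> x"
    and cont0: "\<And>d. down \<iota> (\<lambda>n. \<iota> (d n)) 0 \<Longrightarrow> (\<lambda>n. \<phi> (d n)) \<longlonglongrightarrow> \<phi> 0"
    and d: "down \<iota> (\<lambda>n. \<iota> (d n)) 0"
  shows "(\<lambda>n. \<phi> (x + d n)) \<longlonglongrightarrow> \<phi> x"
proof -
  have "0 \<le> d n" for n
    using down_le[OF d] riesz_embedding_le_iff[OF \<iota>, of 0] linear_0[OF riesz_embedding_linear[OF \<iota>]] by simp
  then have lb: "\<phi> x \<le> \<phi> (x + d n)" for n using mono by (simp add: monoD)
  have "decseq (\<lambda>n. \<phi> (x + d n))"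
    using down_decseq[OF \<iota> d] mono by (auto simp: decseq_def intro!: monoD[OF mono])
  then obtain l where l: "(\<lambda>n. \<phi> (x + d n)) \<longlonglongrightarrow> l" using decseq_convergent lb by metis
  have ub: "l \<le> (1 - c) * \<phi> ((1 / (1 - c)) *\<^sub>R x) + c * \<phi> 0" if c: "0 < c" "c < 1" for c
  proof (rule LIMSEQ_le[OF l])
    show "(\<lambda>n. (1 - c) * \<phi> ((1 / (1 - c)) *\<^sub>R x) + c * \<phi> ((1 / c) *\<^sub>R d n))
        \<longlonglongrightarrow> (1 - c) * \<phi> ((1 / (1 - c)) *\<^sub>R x) + c * \<phi> 0"
      using c by (intro tendsto_intros cont0 down_scaleR[OF \<iota> d]) simp
    have "\<phi> (x + d n) \<le> (1 - c) * \<phi> ((1 / (1 - c)) *\<^sub>R x) + c * \<phi> ((1 / c) *\<^sub>R d n)" for n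
      using convex_onD[OF cvx, of c "(1 / (1 - c)) *\<^sub>R x" "(1 / c) *\<^sub>R d n"] c by simp
    then show "\<exists>N. \<forall>n\<ge>N. \<phi> (x + d n) \<le> (1 - c) * \<phi> ((1 / (1 - c)) *\<^sub>R x) + c * \<phi> ((1 / c) *\<^sub>R d n)"
      by blast
  qed
  have "((\<lambda>c. (1 / (1 - c)) *\<^sub>R x) \<longlongrightarrow> x) (at_right 0)" by (auto intro!: tendsto_eq_intros)
  then have "((\<lambda>c. \<phi> ((1 / (1 - c)) *\<^sub>R x)) \<longlongrightarrow> \<phi> x) (at_right 0)"
    by (rule isCont_tendsto_compose[OF cont])
  then have lim: "((\<lambda>c. (1 - c) * \<phi> ((1 / (1 - c)) *\<^sub>R x) + c * \<phi> 0) \<longlongrightarrow> (1 - 0) * \<phi> x + 0 * \<phi> 0) (at_right 0)"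
    by (intro tendsto_intros)
  have "\<forall>\<^sub>F c in at_right 0. l \<le> (1 - c) * \<phi> ((1 / (1 - c)) *\<^sub>R x) + c * \<phi> 0"
    unfolding eventually_at_right_field using ub by (intro exI[of _ 1]) auto
  then have "l \<le> (1 - 0) * \<phi> x + 0 * \<phi> 0" by (intro tendsto_lowerbound[OF lim]) simp_all
  moreover have "\<phi> x \<le> l" using lb by (intro LIMSEQ_le_const[OF l]) auto
  ultimately show ?thesis using l by simp
qed

text \<open>The quotients along \<open>A\<close> and along \<open>B\<close> are both decreasing and
  bounded below. Their limits agree because either limit is at most the other.\<close>

lemma convex_quotient_diff_tendsto_zero:
  fixes \<phi> :: "'a::banach_lattice \<Rightarrow> real"
  assumes \<iota>: "riesz_embedding \<iota>" and cvx: "convex_on UNIV \<phi>" and mono: "mono \<phi>"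
    and cont: "\<And>x. isCont \<phi> x"
    and cont0: "\<And>d. down \<iota> (\<lambda>n. \<iota> (d n)) 0 \<Longrightarrow> (\<lambda>n. \<phi> (d n)) \<longlonglongrightarrow> \<phi> 0"
    and A: "down \<iota> (\<lambda>n. \<iota> (A n)) \<alpha>" and B: "down \<iota> (\<lambda>n. \<iota> (B n)) \<alpha>"
    and h: "\<And>n. h n > 0" "decseq h"
  shows "(\<lambda>n. (\<phi> (u + h n *\<^sub>R A n) - \<phi> (u + h n *\<^sub>R B n)) / h n) \<longlonglongrightarrow> 0"
proof -
  define q where "q k b = (\<phi> (u + k *\<^sub>R b) - \<phi> u) / k" for k b
  have q_mono1: "q k b \<le> q k' b" if "0 < k" "k \<le> k'" for k k' b
    unfolding q_def by (rule convex_quotient_mono[OF cvx that])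
  have q_mono2: "q k b \<le> q k b'" if "0 < k" "b \<le> b'" for k b b'
    unfolding q_def using that
    by (intro divide_right_mono diff_right_mono monoD[OF mono] add_left_mono scaleR_left_mono) auto
  have h_le: "h n \<le> h m" if "m \<le> n" for m n using h(2) that by (simp add: decseq_def)
  have conv: "\<exists>L. (\<lambda>n. q (h n) (C n)) \<longlonglongrightarrow> L \<and> (\<forall>n. L \<le> q (h n) (C n))"
    if C: "down \<iota> (\<lambda>n. \<iota> (C n)) \<alpha>" for C
  proof -
    obtain l where l: "\<And>n. l \<le> C n" using down_lower_bound[OF \<iota> C] by blast
    \<comment> \<open>Convexity at \<open>u\<close>, the midpoint of
      \<open>u - h n *\<^sub>R l\<close> and \<open>u + h n *\<^sub>R l\<close>, bounds the quotient
      in direction \<open>l\<close> below by minus that in direction \<open>- l\<close>, which is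
      largest for the largest step \<open>h 0\<close>.\<close>
    have "- q (h 0) (- l) \<le> q (h n) (C n)" for n
    proof -
      have "\<phi> u \<le> (\<phi> (u - h n *\<^sub>R l) + \<phi> (u + h n *\<^sub>R l)) / 2"
        using convex_onD[OF cvx, of "1/2" "u - h n *\<^sub>R l" "u + h n *\<^sub>R l"]
        by (simp add: algebra_simps flip: scaleR_add_left)
      then have "0 \<le> ((\<phi> (u - h n *\<^sub>R l) - \<phi> u) + (\<phi> (u + h n *\<^sub>R l) - \<phi> u)) / h n"
        using h(1)[of n] by (intro divide_nonneg_pos) auto
      then have "0 \<le> q (h n) (- l) + q (h n) l"
        unfolding q_def by (simp only: add_divide_distrib scaleR_minus_right add_uminus_conv_diff)
      then show ?thesis
        using q_mono1[OF h(1) h_le[of 0 n], of "- l"] q_mono2[OF h(1) l, of n n] by linarith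
    qed
    moreover have "decseq (\<lambda>n. q (h n) (C n))"
      unfolding decseq_def
    proof (intro allI impI)
      fix m n :: nat assume "m \<le> n"
      then have "C n \<le> C m" using down_decseq[OF \<iota> C] by (simp add: decseq_def)
      then have "q (h n) (C n) \<le> q (h n) (C m)" by (rule q_mono2[OF h(1)])
      also have "\<dots> \<le> q (h m) (C m)" by (rule q_mono1[OF h(1) h_le[OF \<open>m \<le> n\<close>]])
      finally show "q (h n) (C n) \<le> q (h m) (C m)" .
    qed
    ultimately obtain L where "(\<lambda>n. q (h n) (C n)) \<longlonglongrightarrow> L" "\<forall>n. L \<le> q (h n) (C n)"
      using decseq_convergent[of "\<lambda>n. q (h n) (C n)" "- q (h 0) (- l)"] by blast
    then show ?thesis by blast
  qed
  \<comment> \<open>For fixed \<open>m\<close>, \<open>C n \<le> C' m + d n\<close> with truncations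
    \<open>d n\<close> that decrease to 0. Raising the step from \<open>h n\<close> to
    \<open>h m\<close> and letting \<open>n\<close> tend to infinity, continuity from above puts
    \<open>L\<close> below the quotient at \<open>C' m\<close>.\<close>
  have le: "L \<le> L'"
    if C: "down \<iota> (\<lambda>n. \<iota> (C n)) \<alpha>" and C': "down \<iota> (\<lambda>n. \<iota> (C' n)) \<alpha>"
      and L: "\<And>n. L \<le> q (h n) (C n)" and L': "(\<lambda>n. q (h n) (C' n)) \<longlonglongrightarrow> L'" for C C' L L'
  proof (rule LIMSEQ_le_const[OF L'], intro exI allI impI)
    fix m
    define d where "d n = sup (C n - C' m) 0" for n
    have d: "down \<iota> (\<lambda>n. \<iota> (d n)) 0"
      unfolding d_def by (rule down_pos_part_diff[OF \<iota> C down_le[OF C']])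
    have "(\<lambda>n. \<phi> (u + h m *\<^sub>R C' m + h m *\<^sub>R d n)) \<longlonglongrightarrow> \<phi> (u + h m *\<^sub>R C' m)"
      by (rule convex_functional_cont_above[OF \<iota> cvx mono cont cont0 down_scaleR[OF \<iota> d h(1)]])
    then have "(\<lambda>n. (\<phi> (u + h m *\<^sub>R C' m + h m *\<^sub>R d n) - \<phi> u) / h m) \<longlonglongrightarrow> q (h m) (C' m)"
      unfolding q_def using h(1)[of m] by (intro tendsto_intros) auto
    then have lim: "(\<lambda>n. q (h m) (C' m + d n)) \<longlonglongrightarrow> q (h m) (C' m)"
      by (simp add: q_def scaleR_add_right add.assoc)
    show "L \<le> q (h m) (C' m)"
    proof (rule LIMSEQ_le_const[OF lim], intro exI allI impI)
      fix n assume "m \<le> n"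
      have "C n - C' m \<le> d n" by (simp add: d_def)
      then have "C n \<le> C' m + d n" by (simp add: diff_le_eq add.commute)
      then show "L \<le> q (h m) (C' m + d n)"
        using L[of n] q_mono1[OF h(1) h_le[OF \<open>m \<le> n\<close>], of "C n"] q_mono2[OF h(1), of "C n" "C' m + d n" m]
        by linarith
    qed
  qed
  obtain LA where LA: "(\<lambda>n. q (h n) (A n)) \<longlonglongrightarrow> LA" "\<And>n. LA \<le> q (h n) (A n)" using conv[OF A] by blast
  obtain LB where LB: "(\<lambda>n. q (h n) (B n)) \<longlonglongrightarrow> LB" "\<And>n. LB \<le> q (h n) (B n)" using conv[OF B] by blast
  have "LA = LB" using le[OF A B LA(2) LB(1)] le[OF B A LB(2) LA(1)] by simp
  then have "(\<lambda>n. q (h n) (A n) - q (h n) (B n)) \<longlonglongrightarrow> 0"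
    using tendsto_diff[OF LA(1) LB(1)] by simp
  then show ?thesis by (simp add: q_def flip: diff_divide_distrib)
qed

section \<open>Independence of the generator from the null sequence\<close>

lemma embedding_in_X_delta: "\<iota> x \<in> X_delta \<iota>"
proof -
  have "down \<iota> (\<lambda>n. \<iota> x) (\<iota> x)" unfolding down_def decreases_to_def decseq_def by auto
  then show ?thesis unfolding X_delta_def by fast
qed

lemma delta_extension_tendsto:
  assumes \<nu>: "delta_extension \<iota> \<mu> \<nu>" and A: "down \<iota> (\<lambda>n. \<iota> (A n)) a"
  shows "(\<lambda>n. \<mu> (A n)) \<longlonglongrightarrow> \<nu> a"
proof -
  have "a \<in> X_delta \<iota>" using A unfolding X_delta_def by blast
  then have "decreases_to (\<lambda>n. \<nu> (\<iota> (A n))) (\<nu> a)"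
    by (intro \<nu>[unfolded delta_extension_def, THEN conjunct2, rule_format] A embedding_in_X_delta)
  then show ?thesis using \<nu> unfolding decreases_to_real_iff delta_extension_def by simp
qed

text \<open>The norm error vanishes under the bounded functional \<open>\<mu>\<close>; the monotone
  part converges because \<open>\<nu>\<close> is continuous from above.\<close>

lemma delta_limit_tendsto:
  assumes \<mu>: "\<mu> \<in> M_space \<iota>" and \<nu>: "delta_extension \<iota> \<mu> \<nu>" and a: "delta_limit \<iota> S x h a"
  shows "(\<lambda>n. \<mu> ((S (h n) x - x) /\<^sub>R h n)) \<longlonglongrightarrow> \<nu> a"
proof -
  interpret \<mu>: bounded_linear \<mu> by (rule M_space_bounded_linear[OF \<mu>])
  obtain A where A: "(\<lambda>n. norm ((S (h n) x - x) /\<^sub>R h n - A n)) \<longlonglongrightarrow> 0"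
      "down \<iota> (\<lambda>n. \<iota> (A n)) a"
    using a unfolding delta_limit_def by blast
  have "(\<lambda>n. \<mu> ((S (h n) x - x) /\<^sub>R h n - A n) + \<mu> (A n)) \<longlonglongrightarrow> 0 + \<nu> a"
    using A by (intro tendsto_add \<mu>.tendsto_zero delta_extension_tendsto[OF \<nu>]) (auto simp: tendsto_norm_zero_iff)
  then show ?thesis by (simp add: \<mu>.diff)
qed

text \<open>Two null sequences are compared along one that follows them alternately.\<close>

lemma delta_limit_unique:
  assumes sep: "M_separates_X_delta \<iota>" and x: "x \<in> gen_domain \<iota> S"
    and h: "\<And>n. h n > 0" "decreases_to h 0" and a: "delta_limit \<iota> S x h a"
    and h': "\<And>n. h' n > 0" "decreases_to h' 0" and a': "delta_limit \<iota> S x h' a'"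
  shows "a = a'"
proof (rule ccontr)
  assume "a \<noteq> a'"
  then obtain \<mu> \<nu> where \<mu>: "\<mu> \<in> M_space \<iota>" and \<nu>: "delta_extension \<iota> \<mu> \<nu>" and ne: "\<nu> a \<noteq> \<nu> a'"
    using sep a a' unfolding M_separates_X_delta_def delta_limit_def by blast
  define f where "f t = \<mu> ((S t x - x) /\<^sub>R t)" for t
  \<comment> \<open>Two errors below \<open>e\<close> and two below \<open>e / 2\<close> will add up
    to less than \<open>3 * e\<close>, the whole gap.\<close>
  define e where "e = \<bar>\<nu> a - \<nu> a'\<bar> / 3"
  have e: "e > 0" using ne by (simp add: e_def)
  have small: "\<exists>t>0. t < \<delta> \<and> \<bar>f t - \<nu> b\<bar> < e"
    if k: "\<And>n. k n > 0" "decreases_to k 0" and b: "delta_limit \<iota> S x k b" and "\<delta> > 0"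
    for k b and \<delta> :: real
  proof -
    have "(\<lambda>n. f (k n)) \<longlonglongrightarrow> \<nu> b" unfolding f_def by (rule delta_limit_tendsto[OF \<mu> \<nu> b])
    then have "\<forall>\<^sub>F n in sequentially. \<bar>f (k n) - \<nu> b\<bar> < e"
      using e by (auto dest: tendstoD simp: dist_real_def)
    moreover have "\<forall>\<^sub>F n in sequentially. k n < \<delta>"
      using k(2) \<open>\<delta> > 0\<close> unfolding decreases_to_real_iff by (auto intro: order_tendstoD)
    ultimately have "\<forall>\<^sub>F n in sequentially. k n < \<delta> \<and> \<bar>f (k n) - \<nu> b\<bar> < e"
      by eventually_elim simp
    then show ?thesis using k(1) eventually_happens'[OF sequentially_bot] by blast
  qed
  define target where "target n = (if even n then \<nu> a else \<nu> a')" for n :: nat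
  have near: "\<exists>t>0. t < \<delta> \<and> \<bar>f t - target n\<bar> < e" if "\<delta> > 0" for \<delta> n
    unfolding target_def using small[OF h a that] small[OF h' a' that] by simp
  \<comment> \<open>The bound by \<open>inverse (real (Suc n))\<close> forces the times to 0, while
    \<open>target\<close> keeps the quotients within \<open>e\<close> of \<open>\<nu> a\<close> at
    even places and of \<open>\<nu> a'\<close> at odd ones.\<close>
  have "\<exists>k. \<forall>n. (k n > 0 \<and> k n < inverse (real (Suc n)) \<and> \<bar>f (k n) - target n\<bar> < e) \<and> k (Suc n) \<le> k n"
  proof (rule dependent_nat_choice)
    show "\<exists>t>0. t < inverse (real (Suc 0)) \<and> \<bar>f t - target 0\<bar> < e" by (rule near) simp
    fix s :: real and n assume s: "s > 0 \<and> s < inverse (real (Suc n)) \<and> \<bar>f s - target n\<bar> < e"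
    obtain t where "t > 0" "t < min s (inverse (real (Suc (Suc n))))" "\<bar>f t - target (Suc n)\<bar> < e"
      using near[of "min s (inverse (real (Suc (Suc n))))" "Suc n"] s by auto
    then show "\<exists>t. (t > 0 \<and> t < inverse (real (Suc (Suc n))) \<and> \<bar>f t - target (Suc n)\<bar> < e) \<and> t \<le> s"
      by (intro exI[of _ t]) auto
  qed
  then obtain k where k: "\<And>n. k n > 0" "\<And>n. k n < inverse (real (Suc n))"
      "\<And>n. \<bar>f (k n) - target n\<bar> < e" "\<And>n. k (Suc n) \<le> k n"
    by blast
  have "k \<longlonglongrightarrow> 0"
    by (rule tendsto_sandwich[OF _ _ tendsto_const LIMSEQ_inverse_real_of_nat])
       (use k in \<open>auto intro!: always_eventually less_imp_le\<close>)
  then have "decreases_to k 0" using k(4) by (simp add: decreases_to_real_iff decseq_SucI)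
  \<comment> \<open>The domain also provides a limit along the alternating sequence, so both kinds
    of places are eventually near \<open>\<nu> b\<close>.\<close>
  then obtain b where b: "delta_limit \<iota> S x k b" using x k(1) unfolding gen_domain_def by blast
  then have lim: "(\<lambda>n. f (k n)) \<longlonglongrightarrow> \<nu> b" unfolding f_def by (rule delta_limit_tendsto[OF \<mu> \<nu>])
  have "\<forall>\<^sub>F n in sequentially. \<bar>f (k n) - \<nu> b\<bar> < e / 2"
    using tendstoD[OF lim, of "e / 2"] e by (simp add: dist_real_def)
  then obtain N where N: "\<And>n. n \<ge> N \<Longrightarrow> \<bar>f (k n) - \<nu> b\<bar> < e / 2" unfolding eventually_sequentially by blast
  have "\<bar>f (k (2 * N)) - \<nu> a\<bar> < e" "\<bar>f (k (2 * N + 1)) - \<nu> a'\<bar> < e"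
    using k(3)[of "2 * N"] k(3)[of "2 * N + 1"] by (simp_all add: target_def)
  moreover have "\<bar>f (k (2 * N)) - \<nu> b\<bar> < e / 2" "\<bar>f (k (2 * N + 1)) - \<nu> b\<bar> < e / 2"
    by (intro N; simp)+
  ultimately have "\<bar>\<nu> a - \<nu> a'\<bar> < 3 * e" by linarith
  then show False by (simp add: e_def)
qed

lemma delta_limit_generator:
  assumes sep: "M_separates_X_delta \<iota>" and x: "x \<in> gen_domain \<iota> S"
    and h: "\<And>n. h n > 0" "decreases_to h 0"
  shows "delta_limit \<iota> S x h (generator \<iota> S x)"
proof -
  obtain a where a: "delta_limit \<iota> S x h a" using x h unfolding gen_domain_def by blast
  have "delta_limit \<iota> S x k a" if k: "\<And>n. k n > 0" "decreases_to k 0" for k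
  proof -
    obtain b where b: "delta_limit \<iota> S x k b" using x k unfolding gen_domain_def by blast
    then show ?thesis using delta_limit_unique[OF sep x h a k b] by simp
  qed
  then have "generator \<iota> S x = a"
    unfolding generator_def using delta_limit_unique[OF sep x _ _ _ h a] h by (intro the_equality) blast+
  then show ?thesis using a by simp
qed

text \<open>For \<open>e > 0\<close> the points where \<open>G\<close> has grown from
  \<open>a\<close> at slope at most \<open>e\<close> form a compact set. Its maximum is
  \<open>b\<close>, since the right derivative would allow a further step from any earlier point.
  Then \<open>e\<close> tends to 0.\<close>

lemma constant_of_right_derivative_zero:
  fixes G :: "real \<Rightarrow> real"
  assumes ab: "a \<le> b" and cont: "continuous_on {a..b} G"
    and deriv: "\<And>s. a \<le> s \<Longrightarrow> s < b \<Longrightarrow> ((\<lambda>h. (G (s + h) - G s) / h) \<longlongrightarrow> 0) (at_right 0)"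
  shows "G b = G a"
proof -
  have *: "\<bar>G b - G a\<bar> \<le> e * (b - a)" if e: "e > 0" for e
  proof -
    define W where "W = {x \<in> {a..b}. \<bar>G x - G a\<bar> \<le> e * (x - a)}"
    have "closed W"
      unfolding W_def by (intro continuous_on_closed_Collect_le continuous_intros cont closed_atLeastAtMost)
    moreover have "W = {a..b} \<inter> W" by (auto simp: W_def)
    ultimately have "compact W" by (metis compact_Int_closed compact_Icc)
    moreover have "a \<in> W" using ab by (simp add: W_def)
    ultimately obtain m where m: "m \<in> W" "\<And>x. x \<in> W \<Longrightarrow> x \<le> m"
      using compact_attains_sup[of W] by blast
    have "m = b"
    proof (rule ccontr)
      assume "m \<noteq> b"
      then have mb: "a \<le> m" "m < b" using m(1) by (auto simp: W_def)
      have "\<forall>\<^sub>F h in at_right 0. \<bar>(G (m + h) - G m) / h\<bar> < e"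
        using tendstoD[OF deriv[OF mb] e] by (simp add: dist_real_def)
      moreover have "\<forall>\<^sub>F h in at_right 0. h < b - m"
        using mb by (intro order_tendstoD(2)[OF tendsto_ident_at]) auto
      ultimately have "\<forall>\<^sub>F h in at_right 0. 0 < h \<and> h < b - m \<and> \<bar>(G (m + h) - G m) / h\<bar> < e"
        using eventually_at_right_less[of 0] by eventually_elim simp
      then obtain h where h: "0 < h" "h < b - m" "\<bar>(G (m + h) - G m) / h\<bar> < e"
        using eventually_happens'[OF trivial_limit_at_right_real] by blast
      then have "\<bar>G (m + h) - G m\<bar> \<le> e * h" by (simp add: abs_divide pos_divide_less_eq)
      moreover have "e * (m + h - a) = e * (m - a) + e * h" by (simp add: algebra_simps)
      moreover have "\<bar>G m - G a\<bar> \<le> e * (m - a)" using m(1) by (simp add: W_def)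
      ultimately have "\<bar>G (m + h) - G a\<bar> \<le> e * (m + h - a)" by linarith
      then have "m + h \<in> W" using h mb by (simp add: W_def)
      then show False using m(2)[of "m + h"] h by simp
    qed
    then show ?thesis using m(1) by (simp add: W_def)
  qed
  have "((\<lambda>e. e * (b - a)) \<longlongrightarrow> 0 * (b - a)) (at_right 0)" by (intro tendsto_intros)
  moreover have "\<forall>\<^sub>F e in at_right 0. \<bar>G b - G a\<bar> \<le> e * (b - a)"
    using eventually_at_right_less[of 0] by eventually_elim (rule *)
  ultimately have "\<bar>G b - G a\<bar> \<le> 0 * (b - a)" by (rule tendsto_lowerbound) simp
  then show ?thesis by simp
qed

section \<open>Averaged orbits\<close>

lemma integral_shift_minus:
  fixes f :: "real \<Rightarrow> real"
  assumes "continuous_on {c - k..d - k} f"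
  shows "integral {c..d} (\<lambda>x. f (x - k)) = integral {c - k..d - k} f"
  using integral_shift[of c "- k" d f] assms by (simp add: o_def)

lemma down_approx_bounded:
  fixes x :: "nat \<Rightarrow> 'a::banach_lattice"
  assumes \<iota>: "riesz_embedding \<iota>" and x: "(\<lambda>n. norm (x n - X n)) \<longlonglongrightarrow> 0" and X: "down \<iota> (\<lambda>n. \<iota> (X n)) a"
  obtains K where "\<And>n. norm (x n) \<le> K"
proof -
  obtain K where K: "\<And>n. norm (X n) \<le> K" using down_bounded[OF \<iota> X] by blast
  have "Bseq (\<lambda>n. x n - X n)" using x by (simp add: tendsto_norm_zero_iff convergent_imp_Bseq convergentI)
  then obtain K' where K': "\<And>n. norm (x n - X n) \<le> K'" unfolding Bseq_def by blast
  have "norm (x n) \<le> K + K'" for n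
    using norm_triangle_ineq[of "X n" "x n - X n"] K[of n] K'[of n] by simp
  then show ?thesis by (rule that)
qed

locale convex_monotone_C0_semigroup = convex_C0_semigroup S
  for S :: "real \<Rightarrow> 'a::banach_lattice \<Rightarrow> 'a" +
  fixes \<iota> :: "'a \<Rightarrow> 'b::riesz_space" and \<mu> :: "'a \<Rightarrow> real"
  assumes \<iota>: "riesz_embedding \<iota>"
    and mono: "\<And>t. t \<ge> 0 \<Longrightarrow> mono (S t)"
    and cont_above: "semigroup_cont_above \<iota> S"
    and \<mu>: "\<mu> \<in> M_space \<iota>"
begin

sublocale \<mu>: bounded_linear \<mu> by (rule M_space_bounded_linear[OF \<mu>])

text \<open>Since \<open>S t 0\<close> is a lower bound, the truncation in
  \<open>down_pos_part_diff\<close> changes nothing, and \<open>S t (d n) - S t 0\<close> decreases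
  to 0.\<close>

lemma functional_cont_above:
  assumes t: "t \<ge> 0" and d: "down \<iota> (\<lambda>n. \<iota> (d n)) 0"
  shows "(\<lambda>n. \<mu> (S t (d n))) \<longlonglongrightarrow> \<mu> (S t 0)"
proof -
  have S: "down \<iota> (\<lambda>n. \<iota> (S t (d n))) (\<iota> (S t 0))"
    using cont_above t d unfolding semigroup_cont_above_def by blast
  have dec: "decseq (\<lambda>n. S t (d n))" by (rule down_decseq[OF \<iota> S])
  have le: "S t 0 \<le> S t (d n)" for n
    using down_le[OF S] riesz_embedding_le_iff[OF \<iota>] by blast
  then have "sup (S t (d n) - S t 0) 0 = S t (d n) - S t 0" for n
    by (simp add: sup_absorb1)
  then have "down \<iota> (\<lambda>n. \<iota> (S t (d n) - S t 0)) 0"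
    using down_pos_part_diff[OF \<iota> S order_refl] by simp
  then have "(\<lambda>n. \<mu> (S t (d n) - S t 0)) \<longlonglongrightarrow> 0"
    using \<mu> unfolding M_space_def by (simp add: decreases_to_real_iff)
  then have "(\<lambda>n. \<mu> (S t (d n)) - \<mu> (S t 0)) \<longlonglongrightarrow> 0" by (simp add: \<mu>.diff)
  then show ?thesis by (rule LIM_zero_cancel)
qed

lemma functional_convex:
  assumes "t \<ge> 0" shows "convex_on UNIV (\<lambda>x. \<mu> (S t x))"
proof (rule convex_onI)
  fix c :: real and x y :: 'a assume "0 < c" "c < 1"
  then have "S t (c *\<^sub>R y + (1 - c) *\<^sub>R x) \<le> c *\<^sub>R S t y + (1 - c) *\<^sub>R S t x"
    using convex[OF assms] unfolding convex_operator_def by simp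
  from M_space_mono[OF \<mu> this]
  show "\<mu> (S t ((1 - c) *\<^sub>R x + c *\<^sub>R y)) \<le> (1 - c) * \<mu> (S t x) + c * \<mu> (S t y)"
    by (simp add: \<mu>.add \<mu>.scaleR add.commute)
qed simp

lemma functional_mono: "t \<ge> 0 \<Longrightarrow> mono (\<lambda>x. \<mu> (S t x))"
  by (intro monoI M_space_mono[OF \<mu>] monoD[OF mono])

lemma functional_isCont: "t \<ge> 0 \<Longrightarrow> isCont (\<lambda>x. \<mu> (S t x)) x"
  by (intro \<mu>.isCont isCont_operator)

lemma functional_lipschitz_uniformly:
  assumes "0 < p"
  shows "\<exists>L\<ge>0. \<forall>t\<in>{p..q}. \<forall>x x'. norm x \<le> r \<longrightarrow> norm x' \<le> r \<longrightarrow>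
    \<bar>\<mu> (S t x) - \<mu> (S t x')\<bar> \<le> L * norm (x - x')"
proof -
  obtain L where L: "L \<ge> 0" "\<And>t x x'. t \<in> {p..q} \<Longrightarrow> norm x \<le> r \<Longrightarrow> norm x' \<le> r \<Longrightarrow>
      norm (S t x - S t x') \<le> L * norm (x - x')"
    using lipschitz_uniformly[OF assms, of q r] by metis
  obtain C where C: "C > 0" "\<And>x. \<bar>\<mu> x\<bar> \<le> norm x * C" using \<mu>.pos_bounded by auto
  have "\<bar>\<mu> (S t x) - \<mu> (S t x')\<bar> \<le> (L * C) * norm (x - x')"
    if "t \<in> {p..q}" "norm x \<le> r" "norm x' \<le> r" for t x x'
  proof -
    have "\<bar>\<mu> (S t x) - \<mu> (S t x')\<bar> \<le> norm (S t x - S t x') * C"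
      using C(2)[of "S t x - S t x'"] by (simp add: \<mu>.diff)
    also have "\<dots> \<le> L * norm (x - x') * C"
      using C(1) by (intro mult_right_mono L(2) that) simp
    finally show ?thesis by (simp add: mult_ac)
  qed
  then show ?thesis using L(1) C(1) by (intro exI[of _ "L * C"]) simp
qed

lemma continuous_on_functional: "continuous_on ({0<..} \<times> UNIV) (\<lambda>(t, x). \<mu> (S t x))"
  using \<mu>.continuous_on[OF continuous_on_semigroup] by (simp add: case_prod_unfold)

text \<open>As \<open>h n \<le> h 0\<close>, all the points concerned lie in one ball; the Lipschitz
  bound there yields a factor \<open>h n\<close> that cancels the division. Uniformity in
  \<open>t\<close> and \<open>n\<close> later supplies the dominating constant.\<close>

lemma functional_quotient_diff_bound:
  assumes p: "0 < p" and h: "\<And>n. h n > 0" "decseq h"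
    and K: "\<And>n. norm (a n) \<le> K" "\<And>n. norm (b n) \<le> K"
  shows "\<exists>L\<ge>0. \<forall>t\<in>{p..q}. \<forall>n.
    \<bar>(\<mu> (S t (u + h n *\<^sub>R a n)) - \<mu> (S t (u + h n *\<^sub>R b n))) / h n\<bar> \<le> L * norm (a n - b n)"
proof -
  define R where "R = norm u + h 0 * K"
  have norm_R: "norm (u + h n *\<^sub>R z) \<le> R" if "norm z \<le> K" for n z
  proof -
    have "h n * norm z \<le> h 0 * K"
      using h that by (intro mult_mono) (auto simp: decseq_def less_imp_le)
    then show ?thesis
      using norm_triangle_ineq[of u "h n *\<^sub>R z"] h(1)[of n] by (simp add: R_def)
  qed
  obtain L where L: "L \<ge> 0" "\<And>t x x'. t \<in> {p..q} \<Longrightarrow> norm x \<le> R \<Longrightarrow> norm x' \<le> R \<Longrightarrow>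
      \<bar>\<mu> (S t x) - \<mu> (S t x')\<bar> \<le> L * norm (x - x')"
    using functional_lipschitz_uniformly[OF p, of q R] by blast
  have "\<bar>(\<mu> (S t (u + h n *\<^sub>R a n)) - \<mu> (S t (u + h n *\<^sub>R b n))) / h n\<bar> \<le> L * norm (a n - b n)"
    if t: "t \<in> {p..q}" for t n
  proof -
    have "\<bar>\<mu> (S t (u + h n *\<^sub>R a n)) - \<mu> (S t (u + h n *\<^sub>R b n))\<bar>
        \<le> L * norm (u + h n *\<^sub>R a n - (u + h n *\<^sub>R b n))"
      by (intro L(2) t norm_R K)
    also have "u + h n *\<^sub>R a n - (u + h n *\<^sub>R b n) = h n *\<^sub>R (a n - b n)" by (simp add: algebra_simps)
    finally show ?thesis using h(1)[of n] by (simp add: abs_divide pos_divide_le_eq mult_ac)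
  qed
  with L(1) show ?thesis by blast
qed

text \<open>The Lipschitz bound absorbs the norm errors, so \<open>a\<close> and \<open>b\<close>
  may be replaced by the decreasing sequences \<open>A\<close> and \<open>B\<close>, to which the
  convexity argument applies.\<close>

lemma functional_quotient_diff_tendsto_zero:
  assumes t: "t > 0" and h: "\<And>n. h n > 0" "decseq h"
    and a: "(\<lambda>n. norm (a n - A n)) \<longlonglongrightarrow> 0" and A: "down \<iota> (\<lambda>n. \<iota> (A n)) \<alpha>"
    and b: "(\<lambda>n. norm (b n - B n)) \<longlonglongrightarrow> 0" and B: "down \<iota> (\<lambda>n. \<iota> (B n)) \<alpha>"
  shows "(\<lambda>n. (\<mu> (S t (u + h n *\<^sub>R a n)) - \<mu> (S t (u + h n *\<^sub>R b n))) / h n) \<longlonglongrightarrow> 0"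
proof -
  have err: "(\<lambda>n. (\<mu> (S t (u + h n *\<^sub>R c n)) - \<mu> (S t (u + h n *\<^sub>R C n))) / h n) \<longlonglongrightarrow> 0"
    if c: "(\<lambda>n. norm (c n - C n)) \<longlonglongrightarrow> 0" and C: "down \<iota> (\<lambda>n. \<iota> (C n)) \<alpha>" for c C
  proof -
    obtain K where K: "\<And>n. norm (C n) \<le> K" using down_bounded[OF \<iota> C] by blast
    obtain K' where K': "\<And>n. norm (c n) \<le> K'" using down_approx_bounded[OF \<iota> c C] by blast
    obtain L where L: "\<And>n. \<bar>(\<mu> (S t (u + h n *\<^sub>R c n)) - \<mu> (S t (u + h n *\<^sub>R C n))) / h n\<bar> \<le> L * norm (c n - C n)"
    proof -
      have "norm (c n) \<le> max K K'" "norm (C n) \<le> max K K'" for n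
        using K[of n] K'[of n] by simp_all
      from functional_quotient_diff_bound[OF t h, where a = c and b = C and q = t and u = u, OF this]
      show ?thesis using that by auto
    qed
    have "norm ((\<mu> (S t (u + h n *\<^sub>R c n)) - \<mu> (S t (u + h n *\<^sub>R C n))) / h n) \<le> norm (c n - C n) * L" for n
      using L[of n] by (simp only: real_norm_def mult.commute)
    then show ?thesis
      using c unfolding tendsto_norm_zero_iff by (rule tendsto_0_le[rotated, OF always_eventually[OF allI]])
  qed
  have mid: "(\<lambda>n. (\<mu> (S t (u + h n *\<^sub>R A n)) - \<mu> (S t (u + h n *\<^sub>R B n))) / h n) \<longlonglongrightarrow> 0"
    using t by (intro convex_quotient_diff_tendsto_zero[OF \<iota> functional_convex functional_mono
      functional_isCont functional_cont_above A B h]) auto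
  have "(\<lambda>n. (\<mu> (S t (u + h n *\<^sub>R a n)) - \<mu> (S t (u + h n *\<^sub>R A n))) / h n
      + (\<mu> (S t (u + h n *\<^sub>R A n)) - \<mu> (S t (u + h n *\<^sub>R B n))) / h n
      - (\<mu> (S t (u + h n *\<^sub>R b n)) - \<mu> (S t (u + h n *\<^sub>R B n))) / h n) \<longlonglongrightarrow> 0 + 0 - 0"
    by (rule tendsto_diff[OF tendsto_add[OF err[OF a A] mid] err[OF b B]])
  then show ?thesis by (simp add: diff_divide_distrib)
qed

text \<open>The function \<open>G\<close> of the introduction.\<close>

definition average :: "real \<Rightarrow> real \<Rightarrow> (real \<Rightarrow> 'a) \<Rightarrow> real \<Rightarrow> real" where
  "average c d y s = integral {c..d} (\<lambda>T. \<mu> (S (T - s) (y s)))"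

text \<open>The condition \<open>t < c\<close> keeps \<open>T - s\<close> positive, where the
  semigroup is jointly continuous.\<close>

lemma continuous_on_average:
  assumes y: "continuous_on {0..t} y" and "t < c"
  shows "continuous_on {0..t} (average c d y)"
proof -
  have y_fst: "continuous_on ({0..t} \<times> {c..d}) (\<lambda>x. y (fst x))"
    by (rule continuous_on_compose2[OF y continuous_on_fst[OF continuous_on_id]]) auto
  have "continuous_on ({0..t} \<times> {c..d}) (\<lambda>p. (\<lambda>(t, x). \<mu> (S t x)) (snd p - fst p, y (fst p)))"
    by (rule continuous_on_compose2[OF continuous_on_functional])
      (use \<open>t < c\<close> in \<open>auto intro!: continuous_intros y_fst\<close>)
  then have "continuous_on {0..t} (\<lambda>s. integral (cbox c d) (\<lambda>T. \<mu> (S (T - s) (y s))))"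
    by (intro integral_continuous_on_param) (simp add: case_prod_unfold)
  then show ?thesis unfolding average_def[abs_def] by simp
qed

text \<open>Without averaging over \<open>T\<close> this fails, already for the translation semigroup: the increment
  of \<open>s \<mapsto> \<mu> (S (T - s) (y s))\<close> involves the operators \<open>S (T - s - h)\<close>, which vary with \<open>h\<close>.\<close>

lemma average_right_derivative_zero:
  assumes s: "0 \<le> s" "s < c" "c \<le> d"
    and lim: "\<And>h. (\<And>n. h n > 0) \<Longrightarrow> decreases_to h 0 \<Longrightarrow>
      \<exists>\<alpha> A B. (\<lambda>n. norm ((S (h n) (y s) - y s) /\<^sub>R h n - A n)) \<longlonglongrightarrow> 0 \<and> down \<iota> (\<lambda>n. \<iota> (A n)) \<alpha> \<and>
        (\<lambda>n. norm ((y (s + h n) - y s) /\<^sub>R h n - B n)) \<longlonglongrightarrow> 0 \<and> down \<iota> (\<lambda>n. \<iota> (B n)) \<alpha>"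
  shows "((\<lambda>h. (average c d y (s + h) - average c d y s) / h) \<longlongrightarrow> 0) (at_right 0)"
proof (rule tendsto_at_right_sequentially)
  \<comment> \<open>Steps shorter than this keep \<open>T - s - h n\<close> above \<open>p\<close>
    for all \<open>T\<close> in \<open>{c..d}\<close>.\<close>
  show "0 < (c - s) / 2" using s by simp
  fix h :: "nat \<Rightarrow> real"
  assume h: "\<And>n. 0 < h n" "\<And>n. h n < (c - s) / 2" "decseq h" "h \<longlonglongrightarrow> 0"
  define u where "u = y s"
  define p where "p = (c - s) / 2"
  define q where "q = d - s"
  define a where "a n = (y (s + h n) - u) /\<^sub>R h n" for n
  define b where "b n = (S (h n) u - u) /\<^sub>R h n" for n
  define F where "F n r = (\<mu> (S r (y (s + h n))) - \<mu> (S r (S (h n) u))) / h n" for n r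
  have p: "p > 0" using s by (simp add: p_def)
  have "decreases_to h 0" using h by (simp add: decreases_to_real_iff)
  then obtain \<alpha> A B where A: "(\<lambda>n. norm (b n - A n)) \<longlonglongrightarrow> 0" "down \<iota> (\<lambda>n. \<iota> (A n)) \<alpha>"
    and B: "(\<lambda>n. norm (a n - B n)) \<longlonglongrightarrow> 0" "down \<iota> (\<lambda>n. \<iota> (B n)) \<alpha>"
    using lim[of h] h(1) unfolding a_def b_def u_def by blast
  have ha: "y (s + h n) = u + h n *\<^sub>R a n" and hb: "S (h n) u = u + h n *\<^sub>R b n" for n
    using h(1)[of n] by (simp_all add: a_def b_def)
  have F_lim: "(\<lambda>n. F n r) \<longlonglongrightarrow> 0" if "r > 0" for r
    unfolding F_def ha hb by (rule functional_quotient_diff_tendsto_zero[OF that h(1,3) B A])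
  have F_bound: "\<exists>K. \<forall>n. \<forall>r\<in>{p..q}. \<bar>F n r\<bar> \<le> K"
  proof -
    obtain Ka where Ka: "\<And>n. norm (a n) \<le> Ka" using down_approx_bounded[OF \<iota> B] by blast
    obtain Kb where Kb: "\<And>n. norm (b n) \<le> Kb" using down_approx_bounded[OF \<iota> A] by blast
    define K where "K = max Ka Kb"
    have K: "norm (a n) \<le> K" "norm (b n) \<le> K" for n
      using Ka[of n] Kb[of n] by (simp_all add: K_def)
    obtain L where L: "L \<ge> 0" "\<And>r n. r \<in> {p..q} \<Longrightarrow> \<bar>F n r\<bar> \<le> L * norm (a n - b n)"
      using functional_quotient_diff_bound[OF p h(1,3), where a = a and b = b and q = q and u = u, OF K]
      unfolding F_def ha hb by blast
    have "\<bar>F n r\<bar> \<le> L * (2 * K)" if "r \<in> {p..q}" for n r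
      using order.trans[OF L(2)[OF that, of n] mult_left_mono[OF _ L(1)], of "2 * K"]
        norm_triangle_ineq4[of "a n" "b n"] K[of n] by simp
    then show ?thesis by blast
  qed
  then obtain K where K: "\<And>n r. r \<in> {p..q} \<Longrightarrow> \<bar>F n r\<bar> \<le> K" by blast
  have cont: "continuous_on {p..q} (\<lambda>r. \<mu> (S r x))" for x
  proof -
    have "continuous_on {p..q} (\<lambda>r. (\<lambda>(t, x). \<mu> (S t x)) (r, x))"
      by (rule continuous_on_compose2[OF continuous_on_functional])
        (use p in \<open>auto intro!: continuous_intros\<close>)
    then show ?thesis by simp
  qed
  have F_cont: "continuous_on {p..q} (F n)" for n
    unfolding F_def[abs_def] using h(1)[of n] by (intro continuous_intros cont) auto
  have F_int: "F n integrable_on {v..w}" if "p \<le> v" "w \<le> q" for n v w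
    using that by (intro integrable_continuous_real continuous_on_subset[OF F_cont]) auto
  have range: "p \<le> c - s - h n" "d - s - h n \<le> q" for n
    using h(1)[of n] h(2)[of n] by (auto simp: p_def q_def field_simps)
  have range': "p \<le> c - s" "c - s \<le> q"
    using s by (auto simp: p_def q_def)
  \<comment> \<open>The substitution leaves an integral of \<open>F n\<close> over an interval
    moving with \<open>n\<close>; it is rewritten over a fixed interval, with corrections on strips
    of length \<open>h n\<close> at both ends.\<close>
  have quotient: "(average c d y (s + h n) - average c d y s) / h n
      = integral {c - s..d - s} (F n) + integral {c - s - h n..c - s} (F n) - integral {d - s - h n..d - s} (F n)" for n
  proof -
    let ?I = "{c - s - h n..d - s - h n}"
    have sub: "?I \<subseteq> {p..q}" using range[of n] by auto
    have le: "c - s - h n \<le> d - s - h n" "c - s - h n \<le> c - s" "d - s - h n \<le> d - s" "d - s \<le> q" "c - s \<le> d - s"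
      using h(1)[of n] s by (auto simp: q_def)
    have cont': "continuous_on ?I (\<lambda>r. \<mu> (S r x))" for x by (rule continuous_on_subset[OF cont sub])
    have "average c d y (s + h n) = integral ?I (\<lambda>r. \<mu> (S r (y (s + h n))))"
      using integral_shift_minus[of c "s + h n" d "\<lambda>r. \<mu> (S r (y (s + h n)))"] cont'
      by (simp add: average_def diff_diff_eq)
    \<comment> \<open>The semigroup law splits off \<open>S (h n)\<close>, so that both averages
      become integrals of the same operators \<open>S r\<close> over the same range of
      \<open>r\<close>.\<close>
    moreover have "average c d y s = integral ?I (\<lambda>r. \<mu> (S r (S (h n) u)))"
    proof -
      have "average c d y s = integral {c..d} (\<lambda>T. \<mu> (S (T - (s + h n)) (S (h n) u)))"
        unfolding average_def
      proof (rule integral_cong)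
        fix T assume "T \<in> {c..d}"
        then show "\<mu> (S (T - s) (y s)) = \<mu> (S (T - (s + h n)) (S (h n) u))"
          using semigroup_add[of "h n" "T - (s + h n)" u] h(1)[of n] range[of n] p by (simp add: u_def)
      qed
      then show ?thesis
        using integral_shift_minus[of c "s + h n" d "\<lambda>r. \<mu> (S r (S (h n) u))"] cont'
        by (simp add: diff_diff_eq)
    qed
    ultimately have "average c d y (s + h n) - average c d y s
        = integral ?I (\<lambda>r. \<mu> (S r (y (s + h n))) - \<mu> (S r (S (h n) u)))"
      using cont' by (simp add: integral_diff integrable_continuous_real)
    then have "(average c d y (s + h n) - average c d y s) / h n = integral ?I (F n)"
      unfolding F_def[abs_def] by (simp only: integral_divide)
    moreover have "integral {c - s - h n..c - s} (F n) + integral {c - s..d - s} (F n) = integral {c - s - h n..d - s} (F n)"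
      using le range[of n] range' by (intro Henstock_Kurzweil_Integration.integral_combine F_int) linarith+
    moreover have "integral ?I (F n) + integral {d - s - h n..d - s} (F n) = integral {c - s - h n..d - s} (F n)"
      using le range[of n] range' by (intro Henstock_Kurzweil_Integration.integral_combine F_int) linarith+
    ultimately show ?thesis by linarith
  qed
  have "(\<lambda>n. integral {c - s..d - s} (F n)) \<longlonglongrightarrow> integral {c - s..d - s} (\<lambda>_. 0)"
  proof (rule dominated_convergence(2))
    show "F n integrable_on {c - s..d - s}" for n using range' by (intro F_int) (auto simp: q_def)
    show "(\<lambda>_. K) integrable_on {c - s..d - s}" by (rule integrable_const_ivl)
    show "norm (F n r) \<le> K" if "r \<in> {c - s..d - s}" for n r
      using that range' K[of r n] by (auto simp: q_def)
    show "(\<lambda>n. F n r) \<longlonglongrightarrow> 0" if "r \<in> {c - s..d - s}" for r using that s by (intro F_lim) auto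
  qed
  \<comment> \<open>Used at \<open>v = c - s\<close> and \<open>v = d - s\<close>: the strips shrink
    while \<open>F n\<close> stays bounded by \<open>K\<close>.\<close>
  moreover have "(\<lambda>n. integral {v - h n..v} (F n)) \<longlonglongrightarrow> 0" if v: "\<And>n. p \<le> v - h n" "v \<le> q" for v
  proof (rule tendsto_0_le[OF h(4)], intro always_eventually allI)
    fix n
    have "norm (integral {v - h n..v} (F n)) \<le> K * (v - (v - h n))"
      using v(1)[of n] v(2) h(1)[of n]
      by (intro integral_bound continuous_on_subset[OF F_cont]) (auto intro!: K)
    then show "norm (integral {v - h n..v} (F n)) \<le> norm (h n) * K" using h(1)[of n] by (simp add: mult.commute)
  qed
  moreover have "p \<le> d - s - h n" for n using range[of n] s by linarith
  ultimately have "(\<lambda>n. integral {c - s..d - s} (F n) + integral {c - s - h n..c - s} (F n)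
      - integral {d - s - h n..d - s} (F n)) \<longlonglongrightarrow> integral {c - s..d - s} (\<lambda>_. 0) + 0 - 0"
    using range range' by (intro tendsto_add tendsto_diff) (auto simp: q_def)
  then show "(\<lambda>n. (average c d y (s + h n) - average c d y s) / h n) \<longlonglongrightarrow> 0"
    unfolding quotient by simp
qed

text \<open>Averages agree at \<open>t\<close> and at 0; differentiating in the upper end of
  integration recovers the integrand at all times after \<open>t\<close>, and strong continuity at 0
  carries the identity to \<open>t\<close>.\<close>

lemma functional_solution_unique:
  assumes y: "continuous_on {0..} y" and t: "t \<ge> 0"
    and lim: "\<And>s h. s \<ge> 0 \<Longrightarrow> (\<And>n. h n > 0) \<Longrightarrow> decreases_to h 0 \<Longrightarrow>
      \<exists>\<alpha> A B. (\<lambda>n. norm ((S (h n) (y s) - y s) /\<^sub>R h n - A n)) \<longlonglongrightarrow> 0 \<and> down \<iota> (\<lambda>n. \<iota> (A n)) \<alpha> \<and>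
        (\<lambda>n. norm ((y (s + h n) - y s) /\<^sub>R h n - B n)) \<longlonglongrightarrow> 0 \<and> down \<iota> (\<lambda>n. \<iota> (B n)) \<alpha>"
  shows "\<mu> (y t) = \<mu> (S t (y 0))"
proof -
  have average: "average c d y t = average c d y 0" if "t < c" "c \<le> d" for c d
  proof (rule constant_of_right_derivative_zero[OF t])
    show "continuous_on {0..t} (average c d y)"
      using that by (intro continuous_on_average continuous_on_subset[OF y]) auto
    show "((\<lambda>h. (average c d y (s + h) - average c d y s) / h) \<longlongrightarrow> 0) (at_right 0)" if "0 \<le> s" "s < t" for s
      using that \<open>t < c\<close> \<open>c \<le> d\<close> lim by (intro average_right_derivative_zero) auto
  qed
  have eq: "\<mu> (S e (y t)) = \<mu> (S (e + t) (y 0))" if e: "e > 0" for e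
  proof -
    \<comment> \<open>\<open>c\<close> must exceed \<open>t\<close>, and \<open>e + t\<close> must
      be interior to \<open>{c..d}\<close> to give a two-sided derivative.\<close>
    define c where "c = t + e / 2"
    define d where "d = t + 2 * e"
    define f where "f T = \<mu> (S (T - t) (y t)) - \<mu> (S T (y 0))" for T
    have cd: "t < c" "c < e + t" "e + t < d" using e by (auto simp: c_def d_def)
    have cont: "continuous_on {c..d} (\<lambda>T. \<mu> (S (T - k) x))" if "k \<le> t" for k x
    proof -
      have "continuous_on {c..d} (\<lambda>T. (\<lambda>(t, x). \<mu> (S t x)) (T - k, x))"
        by (rule continuous_on_compose2[OF continuous_on_functional])
          (use that cd in \<open>auto intro!: continuous_intros\<close>)
      then show ?thesis by simp
    qed
    have cont': "continuous_on {c..d} (\<lambda>T. \<mu> (S T x))" for x using cont[of 0] t by simp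
    have zero: "integral {c..v} f = 0" if v: "v \<in> {c..d}" for v
    proof -
      have sub: "{c..v} \<subseteq> {c..d}" using v by auto
      have "integral {c..v} f = average c v y t - average c v y 0"
        unfolding f_def[abs_def] average_def
        using integral_diff[OF integrable_continuous_real[OF continuous_on_subset[OF cont[of t] sub]]
          integrable_continuous_real[OF continuous_on_subset[OF cont' sub]]] by simp
      then show ?thesis using average[OF cd(1)] v by simp
    qed
    have "((\<lambda>v. integral {c..v} f) has_real_derivative f (e + t)) (at (e + t) within {c..d})"
      unfolding f_def[abs_def] using cd by (intro integral_has_real_derivative continuous_intros cont cont') auto
    then have "((\<lambda>_. 0) has_real_derivative f (e + t)) (at (e + t) within {c..d})"
      by (rule has_field_derivative_transform_within[OF _ zero_less_one]) (use cd zero in auto)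
    then have "((\<lambda>_. 0) has_real_derivative f (e + t)) (at (e + t))"
      using cd by (simp add: at_within_Icc_at)
    then have "f (e + t) = 0" using DERIV_unique DERIV_const by blast
    then show ?thesis by (simp add: f_def)
  qed
  have "\<forall>\<^sub>F e in at_right 0. \<mu> (S e (S t (y 0))) = \<mu> (S e (y t))"
    using eventually_at_right_less[of 0]
  proof eventually_elim
    case (elim e)
    then show ?case using eq[of e] semigroup_add[of t e] t by simp
  qed
  with \<mu>.tendsto[OF tendsto_at_zero] have "((\<lambda>e. \<mu> (S e (y t))) \<longlongrightarrow> \<mu> (S t (y 0))) (at_right 0)"
    by (rule Lim_transform_eventually)
  with \<mu>.tendsto[OF tendsto_at_zero] show ?thesis
    by (rule tendsto_unique[OF trivial_limit_at_right_real])
qed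

end

section \<open>From functionals to vectors by separation of points\<close>

theorem theorem4p1:
  fixes \<iota> :: "'a::banach_lattice \<Rightarrow> 'b::sigma_complete_riesz_space"
    and S :: "real \<Rightarrow> 'a \<Rightarrow> 'a"
    and y :: "real \<Rightarrow> 'a"
  assumes "riesz_embedding \<iota>"
    and "M_separates_X_delta \<iota>"
    and "C0_semigroup S"
    and "\<And>t. t \<ge> 0 \<Longrightarrow> convex_operator (S t)"
    and "\<And>t. t \<ge> 0 \<Longrightarrow> mono (S t)"
    and "semigroup_cont_above \<iota> S"
    and "continuous_on {0..} y"
    and "\<And>t. t \<ge> 0 \<Longrightarrow> y t \<in> gen_domain \<iota> S"
    and "\<And>t h. t \<ge> 0 \<Longrightarrow> (\<And>n. h n > 0) \<Longrightarrow> decreases_to h 0 \<Longrightarrow>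
           \<exists>B. bounded (range B) \<and> decseq B \<and>
               (\<lambda>n. norm ((y (t + h n) - y t) /\<^sub>R h n - B n)) \<longlonglongrightarrow> 0 \<and>
               down \<iota> (\<lambda>n. \<iota> (B n)) (generator \<iota> S (y t))"
  shows "\<forall>t\<ge>0. y t = S t (y 0)"
proof (intro allI impI)
  fix t :: real assume t: "t \<ge> 0"
  have separated: "\<mu> (y t) = \<mu> (S t (y 0))" if \<mu>: "\<mu> \<in> M_space \<iota>" for \<mu>
  proof -
    interpret convex_monotone_C0_semigroup S \<iota> \<mu>
      using assms(1,3-6) \<mu> by unfold_locales
    show ?thesis
    proof (rule functional_solution_unique[OF assms(7) t])
      fix s :: real and h :: "nat \<Rightarrow> real"
      assume s: "s \<ge> 0" and h: "\<And>n. h n > 0" "decreases_to h 0"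
      \<comment> \<open>The generator at \<open>y s\<close> is the common infimum
        \<open>\<alpha>\<close> for the quotients of the orbit and of \<open>y\<close>.\<close>
      have "delta_limit \<iota> S (y s) h (generator \<iota> S (y s))"
        by (rule delta_limit_generator[OF assms(2) assms(8)[OF s] h])
      then show "\<exists>\<alpha> A B. (\<lambda>n. norm ((S (h n) (y s) - y s) /\<^sub>R h n - A n)) \<longlonglongrightarrow> 0 \<and> down \<iota> (\<lambda>n. \<iota> (A n)) \<alpha> \<and>
          (\<lambda>n. norm ((y (s + h n) - y s) /\<^sub>R h n - B n)) \<longlonglongrightarrow> 0 \<and> down \<iota> (\<lambda>n. \<iota> (B n)) \<alpha>"
        using assms(9)[OF s h] unfolding delta_limit_def by blast
    qed
  qed
  show "y t = S t (y 0)"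
  proof (rule ccontr)
    assume "y t \<noteq> S t (y 0)"
    \<comment> \<open>Both vectors embed into \<open>X_delta\<close>, where \<open>M\<close>
      separates points, and there the extension \<open>\<nu>\<close> takes the values of
      \<open>\<mu>\<close>.\<close>
    then have "\<iota> (y t) \<noteq> \<iota> (S t (y 0))" using assms(1) unfolding riesz_embedding_def by (simp add: inj_eq)
    then obtain \<mu> \<nu> where "\<mu> \<in> M_space \<iota>" "delta_extension \<iota> \<mu> \<nu>" "\<nu> (\<iota> (y t)) \<noteq> \<nu> (\<iota> (S t (y 0)))"
      using assms(2) embedding_in_X_delta[of \<iota>] unfolding M_separates_X_delta_def by blast
    then show False using separated unfolding delta_extension_def by simp
  qed
qed

end
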